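(* Let $k$ be a positive integer and let $T$ be a $(k+2)$-tree that is neither $K_2$ nor a star $K_{1,p}$ with $p<2k$. Then any graph $G$ obtained from $T$ by isomorphic $k$-leaf matching is a minimal $k$-extendable bipartite graph that satisfies $$|V_{k+1}|=\frac{2}{2k-1}(m-n+2k).$$ Furthermore: (i) if $T$ is a regular $(k+2)$-tree then $G$ satisfies $|V_{k+1}|=\frac n2+2$, whereas (ii) if $T$ is a star then $G$ satisfies $|E|=\frac{(2k+1)(n-2k)}{2}$.
   Context: All graphs are finite and loopless. For a graph $G=(V,E)$, $n=|V|$, $m=|E|$, and (for the fixed $k$) $V_{k+1}$ is the set of vertices of degree exactly $k+1$. For a positive integer $k$, a connected graph of order at least $2k+2$ is $k$-extendable if it has a matching of size $k$ and each matching of size $k$ extends to a perfect matching. A $k$-extendable graph $G$ is minimal if $G-e$ is not $k$-extendable for each edge $e$. A tree (on at least two vertices) is an $r$-tree if all of its non-leaves have degree at least $r$, and a regular $r$-tree if all of its non-leaves have degree exactly $r$. A star is a tree with exactly one non-leaf, $K_{1,p}$ with $p\ge 2$. Isomorphic $k$-leaf matching: let $T$ be a tree on at least two vertices with leaf set $L$. Let $H$ be the graph obtained from the disjoint union of $k$ copies $T_1,\dots,T_k$ of $T$ by identifying, for each member of $L$, all of its $k$ copies into a single vertex; let $L(H):=L$ be the set of these identified vertices. Let $H'$ be a disjoint copy of $H$. A graph $G$ obtained from $H\cup H'$ by adding a matching, each of whose edges joins a member of $L(H)$ with the corresponding member of $L(H')$ under some fixed isomorphism between $H$ and $H'$ (carrying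 $L(H)$ to $L(H')$), is said to be obtained from $T$ by isomorphic $k$-leaf matching.
   Formalization: The added matching is required to join every member of L(H) to its corresponding member of L(H'); with an unmatched leaf (e.g. k=1, T=K_{1,3}, empty matching) that vertex has degree k, so G is not k-extendable and the claim fails. *)

theory Defs
  imports Complex_Main
begin

text \<open>
  Finite loopless graphs; parallel edges are allowed, so edges are labels and
  \<open>ends\<close> maps an edge to the two-element set of its end vertices.
\<close>

record ('v, 'e) mgraph =
  verts :: "'v set"
  edges :: "'e set"
  ends  :: "'e \<Rightarrow> 'v set"

definition fin_graph :: "('v, 'e) mgraph \<Rightarrow> bool" where
  "fin_graph G \<longleftrightarrow> finite (verts G) \<and> finite (edges G) \<and>
     (\<forall>e\<in>edges G. ends G e \<subseteq> verts G \<and> card (ends G e) = 2)"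

definition vdegree :: "('v, 'e) mgraph \<Rightarrow> 'v \<Rightarrow> nat" where
  "vdegree G v = card {e \<in> edges G. v \<in> ends G e}"

definition verts_of_degree :: "('v, 'e) mgraph \<Rightarrow> nat \<Rightarrow> 'v set" where
  "verts_of_degree G d = {v \<in> verts G. vdegree G v = d}"

definition connected_graph :: "('v, 'e) mgraph \<Rightarrow> bool" where
  "connected_graph G \<longleftrightarrow>
     (\<forall>u\<in>verts G. \<forall>v\<in>verts G. (u, v) \<in> {(x, y). \<exists>e\<in>edges G. ends G e = {x, y}}\<^sup>*)"

definition bipartite_graph :: "('v, 'e) mgraph \<Rightarrow> bool" where
  "bipartite_graph G \<longleftrightarrow> (\<exists>A B. A \<union> B = verts G \<and> A \<inter> B = {} \<and>
     (\<forall>e\<in>edges G. \<exists>a\<in>A. \<exists>b\<in>B. ends G e = {a, b}))"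

text \<open>Isomorphisms consist of a vertex map \<open>f\<close> and an edge map \<open>g\<close>.\<close>

definition graph_isomorphism ::
  "('v, 'e) mgraph \<Rightarrow> ('w, 'f) mgraph \<Rightarrow> ('v \<Rightarrow> 'w) \<Rightarrow> ('e \<Rightarrow> 'f) \<Rightarrow> bool" where
  "graph_isomorphism G H f g \<longleftrightarrow>
     bij_betw f (verts G) (verts H) \<and> bij_betw g (edges G) (edges H) \<and>
     (\<forall>e\<in>edges G. ends H (g e) = f ` ends G e)"

definition isomorphic_graphs :: "('v, 'e) mgraph \<Rightarrow> ('w, 'f) mgraph \<Rightarrow> bool" where
  "isomorphic_graphs G H \<longleftrightarrow> (\<exists>f g. graph_isomorphism G H f g)"

definition del_edge :: "('v, 'e) mgraph \<Rightarrow> 'e \<Rightarrow> ('v, 'e) mgraph" where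
  "del_edge G e = G\<lparr>edges := edges G - {e}\<rparr>"


subsection \<open>Extendability\<close>

definition matching :: "('v, 'e) mgraph \<Rightarrow> 'e set \<Rightarrow> bool" where
  "matching G M \<longleftrightarrow> M \<subseteq> edges G \<and>
     (\<forall>e\<in>M. \<forall>f\<in>M. e \<noteq> f \<longrightarrow> ends G e \<inter> ends G f = {})"

definition perfect_matching :: "('v, 'e) mgraph \<Rightarrow> 'e set \<Rightarrow> bool" where
  "perfect_matching G M \<longleftrightarrow> matching G M \<and> (\<Union>e\<in>M. ends G e) = verts G"

definition extendable :: "nat \<Rightarrow> ('v, 'e) mgraph \<Rightarrow> bool" where
  "extendable k G \<longleftrightarrow> fin_graph G \<and> connected_graph G \<and> card (verts G) \<ge> 2 * k + 2 \<and>
     (\<exists>M. matching G M \<and> card M = k) \<and>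
     (\<forall>M. matching G M \<and> card M = k \<longrightarrow> (\<exists>P. perfect_matching G P \<and> M \<subseteq> P))"

definition minimal_extendable :: "nat \<Rightarrow> ('v, 'e) mgraph \<Rightarrow> bool" where
  "minimal_extendable k G \<longleftrightarrow>
     extendable k G \<and> (\<forall>e\<in>edges G. \<not> extendable k (del_edge G e))"


subsection \<open>Trees\<close>

text \<open>Two distinct parallel edges form a cycle of length 2.\<close>

definition is_cycle :: "('v, 'e) mgraph \<Rightarrow> 'v list \<Rightarrow> 'e list \<Rightarrow> bool" where
  "is_cycle G vs es \<longleftrightarrow>
     length vs = length es \<and> length es \<ge> 2 \<and> distinct vs \<and> distinct es \<and>
     set vs \<subseteq> verts G \<and> set es \<subseteq> edges G \<and>
     (\<forall>i<length es. ends G (es ! i) = {vs ! i, vs ! (Suc i mod length vs)})"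

text \<open>Only trees on at least two vertices are considered.\<close>

definition is_tree :: "('v, 'e) mgraph \<Rightarrow> bool" where
  "is_tree T \<longleftrightarrow> fin_graph T \<and> card (verts T) \<ge> 2 \<and> connected_graph T \<and>
     \<not> (\<exists>vs es. is_cycle T vs es)"

definition leaves :: "('v, 'e) mgraph \<Rightarrow> 'v set" where
  "leaves T = verts_of_degree T 1"

definition r_tree :: "nat \<Rightarrow> ('v, 'e) mgraph \<Rightarrow> bool" where
  "r_tree r T \<longleftrightarrow> is_tree T \<and> (\<forall>v \<in> verts T - leaves T. vdegree T v \<ge> r)"

definition regular_r_tree :: "nat \<Rightarrow> ('v, 'e) mgraph \<Rightarrow> bool" where
  "regular_r_tree r T \<longleftrightarrow> is_tree T \<and> (\<forall>v \<in> verts T - leaves T. vdegree T v = r)"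

definition is_star :: "('v, 'e) mgraph \<Rightarrow> bool" where
  "is_star T \<longleftrightarrow> is_tree T \<and> card (verts T - leaves T) = 1"

definition K2 :: "(nat, nat) mgraph" where
  "K2 = \<lparr>verts = {0, 1}, edges = {0}, ends = (\<lambda>_. {0, 1})\<rparr>"

definition K1 :: "nat \<Rightarrow> (nat, nat) mgraph" where
  "K1 p = \<lparr>verts = {0..p}, edges = {1..p}, ends = (\<lambda>i. {0, i})\<rparr>"


subsection \<open>Isomorphic leaf matching\<close>

text \<open>
  Copy number \<open>i < k\<close> of a vertex \<open>v\<close> is \<open>(v, i)\<close>;
  all copies of a leaf are identified with its copy number 0.
\<close>

definition glue :: "('v, 'e) mgraph \<Rightarrow> nat \<Rightarrow> 'v \<Rightarrow> 'v \<times> nat" where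
  "glue T i v = (if v \<in> leaves T then (v, 0) else (v, i))"

definition leaf_glued :: "nat \<Rightarrow> ('v, 'e) mgraph \<Rightarrow> ('v \<times> nat, 'e \<times> nat) mgraph" where
  "leaf_glued k T =
     \<lparr>verts = (\<Union>i<k. glue T i ` verts T),
      edges = edges T \<times> {..<k},
      ends = (\<lambda>(e, i). glue T i ` ends T e)\<rparr>"

definition glued_leaves :: "nat \<Rightarrow> ('v, 'e) mgraph \<Rightarrow> ('v \<times> nat) set" where
  "glued_leaves k T = (\<Union>i<k. glue T i ` leaves T)"

text \<open>The graph \<open>H\<close> with its set \<open>L\<close> of identified vertices, up to isomorphism.\<close>

definition leaf_glued_copy ::
  "nat \<Rightarrow> ('a, 'b) mgraph \<Rightarrow> ('v, 'e) mgraph \<Rightarrow> 'v set \<Rightarrow> bool" where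
  "leaf_glued_copy k T H L \<longleftrightarrow>
     (\<exists>f g. graph_isomorphism (leaf_glued k T) H f g \<and> L = f ` glued_leaves k T)"

text \<open>
  The added matching \<open>M\<close> has exactly one edge between \<open>x\<close> and \<open>\<phi> x\<close> for every
  \<open>x\<close> in \<open>L\<close>, that is, it covers all of \<open>L(H)\<close> and \<open>L(H')\<close>.
\<close>

definition isomorphic_leaf_matching ::
  "nat \<Rightarrow> ('a, 'b) mgraph \<Rightarrow> ('v, 'e) mgraph \<Rightarrow> bool" where
  "isomorphic_leaf_matching k T G \<longleftrightarrow> fin_graph G \<and>
     (\<exists>(H :: ('v, 'e) mgraph) L (H' :: ('v, 'e) mgraph) L' \<phi> \<psi> M.
        leaf_glued_copy k T H L \<and> leaf_glued_copy k T H' L' \<and>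
        graph_isomorphism H H' \<phi> \<psi> \<and> \<phi> ` L = L' \<and>
        verts H \<inter> verts H' = {} \<and> edges H \<inter> edges H' = {} \<and>
        M \<inter> (edges H \<union> edges H') = {} \<and>
        verts G = verts H \<union> verts H' \<and>
        edges G = edges H \<union> edges H' \<union> M \<and>
        (\<forall>e\<in>edges H. ends G e = ends H e) \<and>
        (\<forall>e\<in>edges H'. ends G e = ends H' e) \<and>
        bij_betw (ends G) M ((\<lambda>x. {x, \<phi> x}) ` L))"

end

(*
  By Hall's theorem, every matching of at most k edges in a balanced bipartite graph on 2N vertices
  extends to a perfect matching as soon as every independent set meeting both colour classes has
  at most N - k elements. Let T have inner vertices I and leaves L, so that N = k |I| + |L|.
  An independent set of G is given by its traces Z_i, Z'_i in I (one for each copy of T in H and in H')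
  and two disjoint sets P, Q of leaves. If the largest Z_i and Z'_j have together fewer than |I| elements,
  the bound is immediate. Otherwise either they overlap, or they partition I; in the latter case
  some other trace does not follow this partition unless the set is contained in one colour class.
  In all these cases a nonempty independent set Y of inner vertices has at least (k + 1) |Y| + 1
  neighbours, because T is a forest with inner degrees at least k + 2, and these neighbours are lost
  for the independent set. The hypothesis on stars is needed when the overlap is all of I.

  For minimality, deleting an edge at a leaf leaves a vertex of degree k, whose neighbours can be
  used up by a matching; deleting a copy of an inner edge contradicts the balance of an edge cut.
*)

theory Submission imports Defs
begin

subsection \<open>Hall's theorem and extension of matchings\<close>

text \<open>The colours of T are reversed in H', which gives both colour classes of G exactly k |I|
  + |L| vertices. Largest traces are used because losses are weighed differently: an inner vertex
  missing from a largest trace costs k, once per copy, whereas a missing leaf, or a vertex missing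
  from a single trace, costs only 1. Expansion controls the cheap losses. A copy that departs from
  the partition in Y gains |Y| vertices and loses at least (k + 1) |Y| + 1. If the largest traces
  share C, then k |C| is gained against at least (k + 1) |C| + 1 lost neighbours, a margin of only
  |C| + 1. The rest of the required k comes from an inner vertex outside both traces; if there is
  none, T is a star. In a star with p leaves the 2k copies of the centre are independent while N - k
  = p, and this is the origin of the bound 2k. For an inner edge, the copies in H and in H' cross
  the cut with opposite colours, so balance forces equally many of each into a perfect
  matching.\<close>

theorem hall_marriage:
  fixes N :: "'x \<Rightarrow> 'y set"
  assumes "finite A" and "\<And>a. a \<in> A \<Longrightarrow> finite (N a)"
    and "\<And>X. X \<subseteq> A \<Longrightarrow> card X \<le> card (\<Union>(N ` X))"
  shows "\<exists>f. inj_on f A \<and> (\<forall>a\<in>A. f a \<in> N a)"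
  using assms
proof (induction "card A" arbitrary: A N rule: less_induct)
  case less
  note fin = less.prems(1,2) and hall = less.prems(3)
  show ?case
  \<comment> \<open>A tight nonempty proper subset \<open>X\<close> exhausts its neighbourhood, so
    \<open>X\<close> and \<open>A - X\<close> can be matched separately. Without one, every nonempty
    proper subset has a neighbour to spare, and any single pair \<open>a\<close>, \<open>b\<close>
    can be removed.\<close>
  proof (cases "\<exists>X. X \<subset> A \<and> X \<noteq> {} \<and> card (\<Union>(N ` X)) = card X")
    case True
    then obtain X where X: "X \<subset> A" "X \<noteq> {}" "card (\<Union>(N ` X)) = card X" by blast
    have finX: "finite X" using X(1) fin(1) by (metis finite_subset psubset_imp_subset)
    have finNX: "finite (\<Union>(N ` X))" using finX fin(2) X(1) by auto
    have "\<exists>f. inj_on f X \<and> (\<forall>a\<in>X. f a \<in> N a)"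
      using X(1) fin finX hall by (intro less.hyps psubset_card_mono) auto
    then obtain f where f: "inj_on f X" "\<forall>a\<in>X. f a \<in> N a" by blast
    have "\<exists>g. inj_on g (A - X) \<and> (\<forall>a\<in>A - X. g a \<in> N a - \<Union>(N ` X))"
    proof (rule less.hyps)
      show "card (A - X) < card A"
        using X fin(1) by (intro psubset_card_mono) auto
    next
      fix Y assume Y: "Y \<subseteq> A - X"
      then have finY: "finite Y" using fin(1) finite_subset by blast
      have finNY: "finite (\<Union>a\<in>Y. N a - \<Union>(N ` X))"
        using finY fin(2) Y by auto
      have "card X + card Y = card (X \<union> Y)"
        using Y finX finY by (subst card_Un_disjoint) auto
      also have "\<dots> \<le> card (\<Union>(N ` (X \<union> Y)))"
        using Y X(1) by (intro hall) auto
      also have "\<Union>(N ` (X \<union> Y)) = \<Union>(N ` X) \<union> (\<Union>a\<in>Y. N a - \<Union>(N ` X))" by auto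
      also have "card \<dots> = card X + card (\<Union>a\<in>Y. N a - \<Union>(N ` X))"
        using X(3) finNX finNY by (subst card_Un_disjoint) auto
      finally show "card Y \<le> card (\<Union>a\<in>Y. N a - \<Union>(N ` X))" by simp
    qed (use fin in auto)
    then obtain g where g: "inj_on g (A - X)" "\<forall>a\<in>A - X. g a \<in> N a - \<Union>(N ` X)" by blast
    have "inj_on (\<lambda>a. if a \<in> X then f a else g a) A"
    proof (rule inj_onI)
      fix x y assume *: "x \<in> A" "y \<in> A" "(if x \<in> X then f x else g x) = (if y \<in> X then f y else g y)"
      have "f u \<noteq> g v" if "u \<in> X" "v \<in> A - X" for u v
        using that f(2) g(2) by (metis DiffE UN_I)
      then show "x = y"
        using * inj_onD[OF f(1), of x y] inj_onD[OF g(1), of x y]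
        by (cases "x \<in> X"; cases "y \<in> X") (auto, metis)
    qed
    with f g show ?thesis
      by (intro exI[of _ "\<lambda>a. if a \<in> X then f a else g a"]) auto
  next
    case slack: False
    show ?thesis
    proof (cases "A = {}")
      case False
      then obtain a where a: "a \<in> A" by blast
      have "N a \<noteq> {}" using hall[of "{a}"] a by auto
      then obtain b where b: "b \<in> N a" by blast
      have "\<exists>f. inj_on f (A - {a}) \<and> (\<forall>x\<in>A - {a}. f x \<in> N x - {b})"
      proof (rule less.hyps)
        show "card (A - {a}) < card A" using fin(1) a by (rule card_Diff1_less)
      next
        fix Y assume Y: "Y \<subseteq> A - {a}"
        then have finNY: "finite (\<Union>(N ` Y))"
          using fin finite_subset by (metis (no_types, lifting) Diff_subset finite_UN_I subset_eq)
        have eq: "(\<Union>x\<in>Y. N x - {b}) = \<Union>(N ` Y) - {b}" by auto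
        show "card Y \<le> card (\<Union>x\<in>Y. N x - {b})"
        proof (cases "Y = {}")
          case False
          have "card Y \<noteq> card (\<Union>(N ` Y))" "card Y \<le> card (\<Union>(N ` Y))"
            using slack Y a False hall[of Y] by (metis Diff_iff insertCI psubsetI subset_eq, auto)
          then show ?thesis unfolding eq using finNY by (auto simp: card_Diff_singleton_if)
        qed simp
      qed (use fin in auto)
      then obtain f where f: "inj_on f (A - {a})" "\<forall>x\<in>A - {a}. f x \<in> N x - {b}" by blast
      have "inj_on (f(a := b)) A"
      proof (rule inj_onI)
        fix x y assume "x \<in> A" "y \<in> A" "(f(a := b)) x = (f(a := b)) y"
        then show "x = y"
          using f(2) inj_onD[OF f(1), of x y] by (cases "x = a"; cases "y = a") auto
      qed
      with f b show ?thesis by (intro exI[of _ "f(a := b)"]) auto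
    qed simp
  qed
qed

section \<open>Bipartite graphs: counting with matchings, extension and its obstructions\<close>

definition adj :: "('v, 'e) mgraph \<Rightarrow> 'v \<Rightarrow> 'v \<Rightarrow> bool" where
  "adj G u v \<longleftrightarrow> (\<exists>e\<in>edges G. ends G e = {u, v})"

text \<open>The body of \<open>bipartite_graph\<close> with its witnesses as arguments, so that the
  classes can be counted.\<close>

definition sides :: "('v, 'e) mgraph \<Rightarrow> 'v set \<Rightarrow> 'v set \<Rightarrow> bool" where
  "sides G A B \<longleftrightarrow> A \<union> B = verts G \<and> A \<inter> B = {} \<and>
     (\<forall>e\<in>edges G. \<exists>a\<in>A. \<exists>b\<in>B. ends G e = {a, b})"

lemma sides_swap: "sides G A B \<Longrightarrow> sides G B A"
  unfolding sides_def by (metis Int_commute Un_commute insert_commute)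

lemma matching_unique:
  assumes "matching G M" "e \<in> M" "f \<in> M" "v \<in> ends G e" "v \<in> ends G f"
  shows "e = f"
  using assms unfolding matching_def by blast

text \<open>An edge has only one end in \<open>A\<close>, and disjoint edges have different ends, so
  choosing the end in \<open>S\<close> is a bijection.\<close>

lemma card_matched_side:
  assumes "sides G A B" "matching G M" "finite M" "S \<subseteq> A"
  shows "card (S \<inter> (\<Union>e\<in>M. ends G e)) = card {e \<in> M. ends G e \<inter> S \<noteq> {}}"
proof -
  have "\<exists>a. a \<in> S \<and> a \<in> ends G e" if "e \<in> {e \<in> M. ends G e \<inter> S \<noteq> {}}" for e
    using that by blast
  then obtain f where f: "\<And>e. e \<in> {e \<in> M. ends G e \<inter> S \<noteq> {}} \<Longrightarrow> f e \<in> S \<and> f e \<in> ends G e"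
    by metis
  have one: "a = a'" if "e \<in> M" "a \<in> S" "a' \<in> S" "a \<in> ends G e" "a' \<in> ends G e" for a a' e
  proof -
    have "e \<in> edges G" using that assms(2) by (auto simp: matching_def)
    then obtain x y where "x \<in> A" "y \<in> B" "ends G e = {x, y}"
      using assms(1) by (auto simp: sides_def)
    moreover have "a \<in> A" "a' \<in> A" using that assms(4) by auto
    ultimately show ?thesis using that assms(1) by (auto simp: sides_def)
  qed
  have "bij_betw f {e \<in> M. ends G e \<inter> S \<noteq> {}} (S \<inter> (\<Union>e\<in>M. ends G e))"
    unfolding bij_betw_def
  proof
    show "inj_on f {e \<in> M. ends G e \<inter> S \<noteq> {}}"
    proof (rule inj_onI)
      fix d e assume "d \<in> {e \<in> M. ends G e \<inter> S \<noteq> {}}" "e \<in> {e \<in> M. ends G e \<inter> S \<noteq> {}}" "f d = f e"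
      then show "d = e" using matching_unique[OF assms(2), of d e "f d"] f[of d] f[of e] by auto
    qed
    show "f ` {e \<in> M. ends G e \<inter> S \<noteq> {}} = S \<inter> (\<Union>e\<in>M. ends G e)"
    proof
      show "f ` {e \<in> M. ends G e \<inter> S \<noteq> {}} \<subseteq> S \<inter> (\<Union>e\<in>M. ends G e)" using f by blast
      show "S \<inter> (\<Union>e\<in>M. ends G e) \<subseteq> f ` {e \<in> M. ends G e \<inter> S \<noteq> {}}"
      proof
        fix a assume "a \<in> S \<inter> (\<Union>e\<in>M. ends G e)"
        then obtain e where e: "e \<in> M" "a \<in> S" "a \<in> ends G e" by blast
        then have "f e = a" using f[of e] one[of e "f e" a] by blast
        then show "a \<in> f ` {e \<in> M. ends G e \<inter> S \<noteq> {}}" using e by blast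
      qed
    qed
  qed
  from bij_betw_same_card[OF this] show ?thesis by simp
qed

text \<open>Hall's theorem is applied to what \<open>M\<close> leaves uncovered. A set
  \<open>X\<close> on one side and its uncovered non-neighbours \<open>Y\<close> form an independent
  set, so \<open>expand\<close> bounds \<open>card X + card Y\<close>; its slack \<open>k\<close>
  pays for the \<open>card M\<close> vertices removed from each side. If \<open>Y\<close> is empty,
  then \<open>X\<close> sees the whole remaining side, which is as large as
  \<open>A - V\<close>.\<close>

lemma matching_extends:
  assumes fin: "fin_graph G" and AB: "sides G A B" and bal: "card A = card B"
    and expand: "\<And>X Y. X \<subseteq> A \<Longrightarrow> Y \<subseteq> B \<Longrightarrow> X \<noteq> {} \<Longrightarrow> Y \<noteq> {} \<Longrightarrow>
      (\<And>x y. x \<in> X \<Longrightarrow> y \<in> Y \<Longrightarrow> \<not> adj G x y) \<Longrightarrow> card X + card Y + k \<le> card A"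
    and M: "matching G M" "card M \<le> k"
  shows "\<exists>P. perfect_matching G P \<and> M \<subseteq> P"
proof -
  define V where "V = (\<Union>e\<in>M. ends G e)"
  have finM: "finite M" using M(1) fin by (auto simp: matching_def fin_graph_def intro: finite_subset)
  have finAB: "finite A" "finite B"
    using fin AB by (auto simp: fin_graph_def sides_def) (metis finite_Un)+
  have edge: "\<exists>a\<in>A. \<exists>b\<in>B. ends G e = {a, b}" if "e \<in> edges G" for e
    using AB that by (auto simp: sides_def)
  have ME: "M \<subseteq> edges G" using M(1) by (simp add: matching_def)
  have "{e \<in> M. ends G e \<inter> A \<noteq> {}} = M" "{e \<in> M. ends G e \<inter> B \<noteq> {}} = M"
    using ME edge by blast+
  then have cM: "card (A \<inter> V) = card M" "card (B \<inter> V) = card M"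
    using card_matched_side[OF AB M(1) finM, of A] card_matched_side[OF sides_swap[OF AB] M(1) finM, of B]
    by (simp_all add: V_def)
  have cA: "card (A - V) + card M = card A" and cB: "card (B - V) + card M = card A"
    using cM finAB bal card_Int_Diff[of A V] card_Int_Diff[of B V] by simp_all
  have "\<exists>f. inj_on f (A - V) \<and> (\<forall>a\<in>A - V. f a \<in> {b \<in> B - V. adj G a b})"
  proof (rule hall_marriage)
    fix X assume X: "X \<subseteq> A - V"
    define NX where "NX = (\<Union>a\<in>X. {b \<in> B - V. adj G a b})"
    define Y where "Y = B - V - NX"
    have NX: "NX \<subseteq> B - V" by (auto simp: NX_def)
    then have cY: "card Y + card NX = card (B - V)"
      unfolding Y_def using finAB by (metis card_Diff_subset card_mono finite_Diff finite_subset le_add_diff_inverse2)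
    have "card X \<le> card NX"
    proof (cases "X = {} \<or> Y = {}")
      case True
      then show ?thesis
      proof
        assume "Y = {}"
        then have "card NX = card (A - V)" using cY cA cB by simp
        then show ?thesis using X finAB by (simp add: card_mono)
      qed simp
    next
      case False
      have "card X + card Y + k \<le> card A"
        using False X by (intro expand) (auto simp: Y_def NX_def)
      then show ?thesis using cY cB M(2) by linarith
    qed
    then show "card X \<le> card (\<Union>a\<in>X. {b \<in> B - V. adj G a b})" by (simp add: NX_def)
  qed (use finAB in auto)
  then obtain f where f: "inj_on f (A - V)" "\<And>a. a \<in> A - V \<Longrightarrow> f a \<in> B - V \<and> adj G a (f a)" by auto
  then obtain g where g: "\<And>a. a \<in> A - V \<Longrightarrow> g a \<in> edges G \<and> ends G (g a) = {a, f a}"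
    unfolding adj_def by metis
  \<comment> \<open>Equal sizes of the two remaining sides turn the injection into a bijection; this
    is what makes the matching perfect.\<close>
  have surj: "f ` (A - V) = B - V"
    using f finAB cA cB by (intro card_subset_eq) (auto simp: card_image)
  have disj: "A \<inter> B = {}" and un: "A \<union> B = verts G" using AB by (auto simp: sides_def)
  have "matching G (M \<union> g ` (A - V))"
    unfolding matching_def
  proof (intro conjI ballI impI)
    show "M \<union> g ` (A - V) \<subseteq> edges G" using ME g by auto
  next
    have MV: "ends G e \<inter> ends G (g a) = {}" if "e \<in> M" "a \<in> A - V" for e a
      using that f(2)[of a] g[of a] by (auto simp: V_def)
    have gg: "ends G (g a) \<inter> ends G (g b) = {}" if ab: "a \<in> A - V" "b \<in> A - V" "g a \<noteq> g b" for a b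
    proof -
      have "a \<noteq> b" using ab by blast
      moreover have "f a \<noteq> f b" using inj_onD[OF f(1), of a b] ab by blast
      moreover have "a \<noteq> f b" "f a \<noteq> b" using f(2) ab disj by blast+
      ultimately show ?thesis using g ab by simp
    qed
    fix e e' assume "e \<in> M \<union> g ` (A - V)" "e' \<in> M \<union> g ` (A - V)" "e \<noteq> e'"
    then show "ends G e \<inter> ends G e' = {}"
    proof (elim UnE imageE)
      assume "e \<in> M" "e' \<in> M"
      then show ?thesis using M(1) \<open>e \<noteq> e'\<close> unfolding matching_def by blast
    next
      fix a assume "e \<in> M" "e' = g a" "a \<in> A - V"
      then show ?thesis using MV by simp
    next
      fix a assume "e' \<in> M" "e = g a" "a \<in> A - V"
      then show ?thesis using MV[of e' a] by (simp add: Int_commute)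
    next
      fix a b assume "e = g a" "a \<in> A - V" "e' = g b" "b \<in> A - V"
      then show ?thesis using gg \<open>e \<noteq> e'\<close> by simp
    qed
  qed
  moreover have "(\<Union>e\<in>M \<union> g ` (A - V). ends G e) = verts G"
  proof
    show "(\<Union>e\<in>M \<union> g ` (A - V). ends G e) \<subseteq> verts G"
      using ME g fin by (fastforce simp: fin_graph_def)
    have "A - V \<subseteq> (\<Union>e\<in>g ` (A - V). ends G e)" "f ` (A - V) \<subseteq> (\<Union>e\<in>g ` (A - V). ends G e)"
      using g by auto
    then show "verts G \<subseteq> (\<Union>e\<in>M \<union> g ` (A - V). ends G e)"
      unfolding surj using un V_def by auto
  qed
  ultimately show ?thesis unfolding perfect_matching_def by blast
qed

lemma extendableI:
  assumes fin: "fin_graph G" and con: "connected_graph G"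
    and AB: "sides G A B" and bal: "card A = card B" and big: "k < card A"
    and expand: "\<And>X Y. X \<subseteq> A \<Longrightarrow> Y \<subseteq> B \<Longrightarrow> X \<noteq> {} \<Longrightarrow> Y \<noteq> {} \<Longrightarrow>
      (\<And>x y. x \<in> X \<Longrightarrow> y \<in> Y \<Longrightarrow> \<not> adj G x y) \<Longrightarrow> card X + card Y + k \<le> card A"
  shows "extendable k G"
proof -
  note ext = matching_extends[OF fin AB bal expand]
  have finAB: "finite A" "finite B"
    using fin AB by (auto simp: fin_graph_def sides_def) (metis finite_Un)+
  have "card (verts G) = card A + card B"
    using AB finAB by (metis sides_def card_Un_disjoint)
  then have n: "card (verts G) \<ge> 2 * k + 2" using bal big by simp
  \<comment> \<open>\<open>matching_extends\<close> admits all matchings of at most \<open>k\<close>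
    edges, in particular the empty one. Any \<open>k\<close> edges of the resulting perfect matching
    witness that a matching of size \<open>k\<close> exists.\<close>
  have "\<exists>P. perfect_matching G P \<and> {} \<subseteq> P" by (rule ext) (auto simp: matching_def)
  then obtain P where P: "perfect_matching G P" by blast
  then have PM: "matching G P" and PV: "(\<Union>e\<in>P. ends G e) = verts G"
    by (auto simp: perfect_matching_def)
  have finP: "finite P" using PM fin by (auto simp: matching_def fin_graph_def intro: finite_subset)
  have "card A = card {e \<in> P. ends G e \<inter> A \<noteq> {}}"
    using card_matched_side[OF AB PM finP, of A] AB PV by (simp add: sides_def) (metis Int_absorb2 Un_upper1)
  also have "\<dots> \<le> card P" using finP by (intro card_mono) auto
  finally obtain M where "M \<subseteq> P" "card M = k" using big obtain_subset_with_card_n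
    by (metis less_imp_le order_trans)
  moreover have "matching G M" using \<open>M \<subseteq> P\<close> PM unfolding matching_def by blast
  ultimately have "\<exists>M. matching G M \<and> card M = k" by blast
  moreover have "\<exists>P. perfect_matching G P \<and> M \<subseteq> P" if "matching G M" "card M = k" for M
    using that by (intro ext) simp_all
  ultimately show ?thesis unfolding extendable_def using fin con n by blast
qed

text \<open>An edge covering \<open>v\<close> in an extension of \<open>M\<close> would share its
  other end with a member of \<open>M\<close>.\<close>

lemma not_extendable_blocked:
  assumes "matching G M" "card M = k" "v \<in> verts G" "v \<notin> (\<Union>e\<in>M. ends G e)"
    and "\<And>e. e \<in> edges G \<Longrightarrow> v \<in> ends G e \<Longrightarrow> ends G e \<inter> (\<Union>e\<in>M. ends G e) \<noteq> {}"
  shows "\<not> extendable k G"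
proof
  assume "extendable k G"
  then obtain P where P: "matching G P" "(\<Union>e\<in>P. ends G e) = verts G" "M \<subseteq> P"
    using assms(1,2) unfolding extendable_def perfect_matching_def by blast
  then obtain e where e: "e \<in> P" "v \<in> ends G e" using assms(3) by blast
  then have "e \<in> edges G" using P(1) by (auto simp: matching_def)
  then obtain f u where "f \<in> M" "u \<in> ends G f" "u \<in> ends G e" using assms(5) e(2) by blast
  then have "e = f" using matching_unique[OF P(1)] P(3) e(1) by blast
  then show False using \<open>f \<in> M\<close> e(2) assms(4) by blast
qed

text \<open>Edges inside \<open>U\<close> use one vertex from each class. If \<open>U\<close> is
  balanced, equally many vertices of the two classes are left over, and these are matched across the
  cut.\<close>

lemma perfect_matching_cut:
  assumes fin: "fin_graph G" and AB: "sides G A B" and P: "perfect_matching G P"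
    and U: "card (A \<inter> U) = card (B \<inter> U)"
  shows "card {e \<in> P. ends G e \<inter> (A \<inter> U) \<noteq> {} \<and> ends G e \<inter> (B \<inter> U) = {}} =
    card {e \<in> P. ends G e \<inter> (B \<inter> U) \<noteq> {} \<and> ends G e \<inter> (A \<inter> U) = {}}"
proof -
  have PM: "matching G P" and PV: "(\<Union>e\<in>P. ends G e) = verts G"
    using P by (auto simp: perfect_matching_def)
  have finP: "finite P" using PM fin by (auto simp: matching_def fin_graph_def intro: finite_subset)
  let ?a = "{e \<in> P. ends G e \<inter> (A \<inter> U) \<noteq> {}}" and ?b = "{e \<in> P. ends G e \<inter> (B \<inter> U) \<noteq> {}}"
  have "A \<inter> U \<subseteq> verts G" "B \<inter> U \<subseteq> verts G" using AB by (auto simp: sides_def)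
  then have "card ?a = card ?b"
    using card_matched_side[OF AB PM finP, of "A \<inter> U"]
      card_matched_side[OF sides_swap[OF AB] PM finP, of "B \<inter> U"] U PV
    by (simp add: Int_absorb2)
  then have "card (?a - ?b) = card (?b - ?a)"
    using finP card_Int_Diff[of ?a ?b] card_Int_Diff[of ?b ?a] by (simp add: Int_commute)
  moreover have "?a - ?b = {e \<in> P. ends G e \<inter> (A \<inter> U) \<noteq> {} \<and> ends G e \<inter> (B \<inter> U) = {}}"
    "?b - ?a = {e \<in> P. ends G e \<inter> (B \<inter> U) \<noteq> {} \<and> ends G e \<inter> (A \<inter> U) = {}}" by auto
  ultimately show ?thesis by simp
qed

subsection \<open>Forests and trees\<close>

lemma adj_sym: "adj G u v \<Longrightarrow> adj G v u"
  by (auto simp: adj_def insert_commute)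

lemma adj_verts:
  assumes "fin_graph G" "adj G u v"
  shows "u \<in> verts G" "v \<in> verts G" "u \<noteq> v"
proof -
  obtain e where "e \<in> edges G" "ends G e = {u, v}" using assms(2) by (auto simp: adj_def)
  then have "{u, v} \<subseteq> verts G" "card {u, v} = 2" using assms(1) unfolding fin_graph_def by metis+
  then show "u \<in> verts G" "v \<in> verts G" "u \<noteq> v" by auto
qed

lemma incident_edge:
  assumes "fin_graph G" "e \<in> edges G" "v \<in> ends G e"
  obtains u where "ends G e = {v, u}" "u \<noteq> v" "adj G v u"
proof -
  have "card (ends G e) = 2" using assms by (simp add: fin_graph_def)
  then have "\<exists>u. ends G e = {v, u} \<and> u \<noteq> v" using assms(3) by (auto simp: card_2_iff)
  then show ?thesis using that assms(2) unfolding adj_def by blast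
qed

text \<open>Vertices and edges are both listed, in the format of \<open>is_cycle\<close>, since
  parallel edges are possible and paths are to be closed to cycles.\<close>

definition is_path :: "('v, 'e) mgraph \<Rightarrow> 'v list \<Rightarrow> 'e list \<Rightarrow> bool" where
  "is_path G vs es \<longleftrightarrow> length vs = Suc (length es) \<and> distinct vs \<and> set vs \<subseteq> verts G \<and>
     set es \<subseteq> edges G \<and> (\<forall>i<length es. ends G (es ! i) = {vs ! i, vs ! Suc i})"

lemma is_path_edge_at_start:
  assumes "is_path G vs es" "i < length es" "vs ! 0 \<in> ends G (es ! i)"
  shows "i = 0"
proof -
  have "vs ! 0 = vs ! i \<or> vs ! 0 = vs ! Suc i" using assms by (auto simp: is_path_def)
  moreover have "distinct vs" "i < length vs" "Suc i < length vs" "0 < length vs"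
    using assms by (auto simp: is_path_def)
  ultimately show ?thesis by (metis nat.distinct(1) nth_eq_iff_index_eq)
qed

lemma distinct_path_edges:
  assumes "is_path G vs es"
  shows "distinct es"
  unfolding distinct_conv_nth
proof (intro allI impI notI)
  fix i j assume ij: "i < length es" "j < length es" "i \<noteq> j" "es ! i = es ! j"
  have "distinct vs" "length vs = Suc (length es)" using assms by (auto simp: is_path_def)
  then have d: "vs ! a = vs ! b \<longleftrightarrow> a = b" if "a \<le> length es" "b \<le> length es" for a b
    using that by (simp add: nth_eq_iff_index_eq)
  have "{vs ! i, vs ! Suc i} = {vs ! j, vs ! Suc j}"
    using assms ij unfolding is_path_def by metis
  then show False using d[of i j] d[of i "Suc j"] d[of "Suc i" j] ij by (auto simp: doubleton_eq_iff)
qed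

text \<open>At the first vertex of a longest path, an edge other than the first path edge must lead
  back to the path, for otherwise the path could be prolonged; this closes a cycle.\<close>

lemma acyclic_low_degree:
  assumes fin: "fin_graph G" and ac: "\<not> (\<exists>vs es. is_cycle G vs es)" and ne: "verts G \<noteq> {}"
  shows "\<exists>v\<in>verts G. vdegree G v \<le> 1"
proof (rule ccontr)
  assume "\<not> ?thesis"
  then have deg: "2 \<le> vdegree G v" if "v \<in> verts G" for v
    using that by force
  define len where "len n \<longleftrightarrow> (\<exists>vs es. is_path G vs es \<and> length vs = n)" for n
  obtain v where "v \<in> verts G" using ne by blast
  then have "is_path G [v] []" by (auto simp: is_path_def)
  then have "len 1" unfolding len_def by fastforce
  have "n \<le> card (verts G)" if n: "len n" for n
  proof -
    obtain vs es where *: "is_path G vs es" "length vs = n" using n unfolding len_def by blast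
    then have "n = card (set vs)" by (simp add: is_path_def distinct_card)
    also have "\<dots> \<le> card (verts G)"
      using * fin by (intro card_mono) (auto simp: is_path_def fin_graph_def)
    finally show ?thesis .
  qed
  then have "len (Greatest len)" "\<And>n. len n \<Longrightarrow> n \<le> Greatest len"
    using \<open>len 1\<close> GreatestI_nat[of len 1 "card (verts G)"] Greatest_le_nat[of len _ "card (verts G)"]
    by auto
  then obtain vs es where p: "is_path G vs es" and max: "\<And>vs' es'. is_path G vs' es' \<Longrightarrow> length vs' \<le> length vs"
    unfolding len_def by metis
  have len: "length vs = Suc (length es)" and dist: "distinct vs" and sub: "set vs \<subseteq> verts G" "set es \<subseteq> edges G"
    and ends: "\<And>i. i < length es \<Longrightarrow> ends G (es ! i) = {vs ! i, vs ! Suc i}"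
    using p by (auto simp: is_path_def)
  have v0: "vs ! 0 \<in> verts G" using sub len by (auto simp: subset_eq)
  have "\<exists>e \<in> edges G. vs ! 0 \<in> ends G e \<and> (es \<noteq> [] \<longrightarrow> e \<noteq> es ! 0)"
  proof (rule ccontr)
    assume "\<not> ?thesis"
    then have "{e \<in> edges G. vs ! 0 \<in> ends G e} \<subseteq> {es ! 0}" by blast
    then have "vdegree G (vs ! 0) \<le> 1" unfolding vdegree_def
      by (metis card.empty card_insert_disjoint card_mono empty_iff finite.simps One_nat_def)
    then show False using deg[OF v0] by simp
  qed
  then obtain e where e: "e \<in> edges G" "vs ! 0 \<in> ends G e" "es \<noteq> [] \<Longrightarrow> e \<noteq> es ! 0" by blast
  have "card (ends G e) = 2" "ends G e \<subseteq> verts G" using fin e by (auto simp: fin_graph_def)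
  then have "\<exists>u. ends G e = {vs ! 0, u} \<and> u \<noteq> vs ! 0 \<and> u \<in> verts G"
    using e(2) by (auto simp: card_2_iff)
  then obtain u where u: "ends G e = {vs ! 0, u}" "u \<noteq> vs ! 0" "u \<in> verts G" by blast
  show False
  proof (cases "u \<in> set vs")
    case False
    have "is_path G (u # vs) (e # es)"
      using len dist sub ends u e(1) False by (auto simp: is_path_def nth_Cons' insert_commute)
    then show False using max by fastforce
  next
    case True
    then obtain j where j: "j < length vs" "vs ! j = u" by (auto simp: in_set_conv_nth)
    have j0: "0 < j" using j u(2) by (cases j) auto
    have new: "e \<notin> set (take j es)"
    proof
      assume "e \<in> set (take j es)"
      then obtain i where i: "i < j" "i < length es" "es ! i = e" by (auto simp: in_set_conv_nth)
      then have "i = 0" using is_path_edge_at_start[OF p i(2)] e(2) by simp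
      then show False using i e(3) by auto
    qed
    have "is_cycle G (take (Suc j) vs) (take j es @ [e])"
      unfolding is_cycle_def
    proof (intro conjI allI impI)
      show "set (take (Suc j) vs) \<subseteq> verts G" using sub(1) set_take_subset by (metis order_trans)
      show "set (take j es @ [e]) \<subseteq> edges G" using sub(2) e(1) set_take_subset[of j es] by auto
      fix i assume "i < length (take j es @ [e])"
      then have "i < j \<or> i = j" using j len by auto
      then show "ends G ((take j es @ [e]) ! i) =
          {take (Suc j) vs ! i, take (Suc j) vs ! (Suc i mod length (take (Suc j) vs))}"
        using j j0 len ends[of i] u(1) by (elim disjE) (auto simp: nth_append insert_commute)
    qed (use j j0 len dist new distinct_path_edges[OF p] in \<open>auto simp: min_def\<close>)
    then show False using ac by blast
  qed
qed

definition induced :: "('v, 'e) mgraph \<Rightarrow> 'v set \<Rightarrow> ('v, 'e) mgraph" where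
  "induced G S = \<lparr>verts = S, edges = {e \<in> edges G. ends G e \<subseteq> S}, ends = ends G\<rparr>"

lemma is_cycle_induced: "is_cycle (induced G S) vs es \<Longrightarrow> S \<subseteq> verts G \<Longrightarrow> is_cycle G vs es"
  unfolding is_cycle_def induced_def by auto

definition proper_colouring :: "('v, 'e) mgraph \<Rightarrow> ('v \<Rightarrow> bool) \<Rightarrow> bool" where
  "proper_colouring G c \<longleftrightarrow> (\<forall>e\<in>edges G. \<forall>u v. ends G e = {u, v} \<longrightarrow> c u \<noteq> c v)"

text \<open>Both claims come from removing a vertex \<open>v\<close> of degree at most 1 in the
  induced graph: at most one edge is lost, and \<open>v\<close> can be coloured opposite to its only
  neighbour.\<close>

lemma forest_induct:
  assumes fin: "fin_graph G" and ac: "\<not> (\<exists>vs es. is_cycle G vs es)" and "S \<subseteq> verts G"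
  shows "(S \<noteq> {} \<longrightarrow> card {e \<in> edges G. ends G e \<subseteq> S} < card S) \<and>
    (\<exists>c. proper_colouring (induced G S) c)"
  using assms(3)
proof (induction "card S" arbitrary: S rule: less_induct)
  case less
  have finS: "finite S" and finE: "finite (edges G)"
    using less.prems fin by (auto simp: fin_graph_def intro: finite_subset)
  have two: "\<exists>x y. x \<noteq> y \<and> ends G e = {x, y}" if "e \<in> edges G" for e
    using that fin unfolding fin_graph_def card_2_iff by metis
  show ?case
  proof (cases "S = {}")
    case True
    have "\<not> ends G e \<subseteq> S" if "e \<in> edges G" for e using two[OF that] True by auto
    then show ?thesis using True by (auto simp: proper_colouring_def induced_def)
  next
    case False
    have "fin_graph (induced G S)" using fin finS by (auto simp: fin_graph_def induced_def)
    moreover have "\<not> (\<exists>vs es. is_cycle (induced G S) vs es)"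
      using ac is_cycle_induced less.prems by blast
    moreover have "verts (induced G S) \<noteq> {}" using False by (simp add: induced_def)
    ultimately have "\<exists>v\<in>verts (induced G S). vdegree (induced G S) v \<le> 1"
      by (rule acyclic_low_degree)
    then obtain v where v: "v \<in> S" and dv: "vdegree (induced G S) v \<le> 1"
      by (auto simp: induced_def)
    define I where "I = {e \<in> edges G. ends G e \<subseteq> S \<and> v \<in> ends G e}"
    have "I = {e \<in> edges (induced G S). v \<in> ends (induced G S) e}"
      by (auto simp: I_def induced_def)
    then have I: "card I \<le> 1" using dv by (simp add: vdegree_def)
    have finI: "finite I" using finE by (simp add: I_def)
    have less': "card (S - {v}) < card S" using finS v by (rule card_Diff1_less)
    note IH = less.hyps[OF this]
    have split: "{e \<in> edges G. ends G e \<subseteq> S} = {e \<in> edges G. ends G e \<subseteq> S - {v}} \<union> I"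
      by (auto simp: I_def)
    have "card {e \<in> edges G. ends G e \<subseteq> S} < card S"
    proof (cases "S - {v} = {}")
      case True
      have "\<not> ends G e \<subseteq> S" if "e \<in> edges G" for e
      proof
        assume "ends G e \<subseteq> S"
        then have "ends G e \<subseteq> {v}" using True by blast
        then show False using two[OF that] by auto
      qed
      then have no: "{e \<in> edges G. ends G e \<subseteq> S} = {}" by blast
      show ?thesis unfolding no using less' by simp
    next
      case False
      have "card {e \<in> edges G. ends G e \<subseteq> S} \<le> card {e \<in> edges G. ends G e \<subseteq> S - {v}} + card I"
        unfolding split by (rule card_Un_le)
      also have "\<dots> < card (S - {v}) + 1"
        using IH False less.prems I by fastforce
      finally show ?thesis using less' by linarith
    qed
    moreover have "\<exists>c. proper_colouring (induced G S) c"
    proof -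
      obtain c where c: "proper_colouring (induced G (S - {v})) c"
        using IH less.prems by blast
      show ?thesis
      proof (cases "I = {}")
        case True
        then have "induced G (S - {v}) = induced G S\<lparr>verts := S - {v}\<rparr>"
          using split by (simp add: induced_def)
        then show ?thesis using c by (auto simp: proper_colouring_def)
      next
        case False
        then have "card I = 1" using I finI by (simp add: card_gt_0_iff le_eq_less_or_eq)
        then obtain e where e: "I = {e}" by (auto simp: card_1_singleton_iff)
        then have "e \<in> edges G" "v \<in> ends G e" by (auto simp: I_def)
        then obtain w where w: "ends G e = {v, w}" "w \<noteq> v" using incident_edge[OF fin] by metis
        have "(c(v := \<not> c w)) x \<noteq> (c(v := \<not> c w)) y"
          if *: "f \<in> edges G" "ends G f \<subseteq> S" "ends G f = {x, y}" for f x y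
        proof (cases "v \<in> {x, y}")
          case True
          then have "f = e" using * e by (auto simp: I_def)
          then have "{x, y} = {v, w}" using * w by simp
          then show ?thesis using w(2) by (auto simp: doubleton_eq_iff)
        next
          case False
          then have "ends G f \<subseteq> S - {v}" using * by auto
          then have "c x \<noteq> c y" using c * by (auto simp: proper_colouring_def induced_def)
          then show ?thesis using False by auto
        qed
        then have "proper_colouring (induced G S) (c(v := \<not> c w))"
          unfolding proper_colouring_def induced_def mgraph.select_convs by blast
        then show ?thesis by blast
      qed
    qed
    ultimately show ?thesis by blast
  qed
qed

lemma forest_edge_bound:
  assumes "fin_graph G" "\<not> (\<exists>vs es. is_cycle G vs es)" "S \<subseteq> verts G" "S \<noteq> {}"
  shows "card {e \<in> edges G. ends G e \<subseteq> S} < card S"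
  using forest_induct[OF assms(1-3)] assms(4) by blast

lemma forest_colouring:
  assumes "fin_graph G" "\<not> (\<exists>vs es. is_cycle G vs es)"
  shows "\<exists>c. proper_colouring G c"
proof -
  have "{e \<in> edges G. ends G e \<subseteq> verts G} = edges G" using assms(1) by (auto simp: fin_graph_def)
  then show ?thesis
    using forest_induct[OF assms subset_refl] by (simp add: proper_colouring_def induced_def)
qed

section \<open>Connectedness, edge counts and cuts in trees\<close>

lemma connected_graph_adj:
  "connected_graph G \<longleftrightarrow> (\<forall>u\<in>verts G. \<forall>v\<in>verts G. (adj G)\<^sup>*\<^sup>* u v)"
proof -
  have "{(x, y). \<exists>e\<in>edges G. ends G e = {x, y}} = {(x, y). adj G x y}" by (simp add: adj_def)
  then show ?thesis unfolding connected_graph_def by (simp add: rtranclp_rtrancl_eq)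
qed

lemma connected_closed:
  assumes "connected_graph G" "u \<in> verts G" "u \<in> S"
    and "\<And>x y. x \<in> S \<Longrightarrow> adj G x y \<Longrightarrow> y \<in> S"
  shows "verts G \<subseteq> S"
proof
  fix v assume "v \<in> verts G"
  then have "(adj G)\<^sup>*\<^sup>* u v" using assms(1,2) by (simp add: connected_graph_adj)
  then show "v \<in> S" by induction (use assms(3,4) in auto)
qed

text \<open>Take a largest set \<open>S\<close> that contains \<open>r\<close> and induces at least
  \<open>card S - 1\<close> edges. Adding a neighbour would bring a new edge with it, so
  \<open>S\<close> is closed under adjacency and is everything.\<close>

lemma connected_edge_bound:
  assumes fin: "fin_graph G" and con: "connected_graph G"
  shows "card (verts G) \<le> card (edges G) + 1"
proof (cases "verts G = {}")
  case False
  then obtain r where r: "r \<in> verts G" by blast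
  have finV: "finite (verts G)" and finE: "finite (edges G)" using fin by (auto simp: fin_graph_def)
  define good where "good S \<longleftrightarrow> S \<subseteq> verts G \<and> r \<in> S \<and> card S \<le> card {e \<in> edges G. ends G e \<subseteq> S} + 1" for S
  have "good {r}" using r by (simp add: good_def)
  moreover have "\<forall>S. good S \<longrightarrow> card S < Suc (card (verts G))"
    using finV by (auto simp: good_def less_Suc_eq_le intro: card_mono)
  ultimately obtain S where S: "good S" and max: "\<And>S'. good S' \<Longrightarrow> card S' \<le> card S"
    using ex_has_greatest_nat[of good "{r}" card "Suc (card (verts G))"] by (metis (no_types))
  have finS: "finite S" using S finV by (auto simp: good_def intro: finite_subset)
  have "verts G \<subseteq> S"
  proof (rule connected_closed[OF con r])
    show "r \<in> S" using S by (simp add: good_def)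
    fix x y assume x: "x \<in> S" and "adj G x y"
    then obtain e where e: "e \<in> edges G" "ends G e = {x, y}" by (auto simp: adj_def)
    show "y \<in> S"
    proof (rule ccontr)
      assume y: "y \<notin> S"
      have "insert e {e \<in> edges G. ends G e \<subseteq> S} \<subseteq> {e \<in> edges G. ends G e \<subseteq> insert y S}"
        using e x by auto
      then have "card (insert e {e \<in> edges G. ends G e \<subseteq> S}) \<le> card {e \<in> edges G. ends G e \<subseteq> insert y S}"
        using finE by (intro card_mono) auto
      moreover have "card (insert e {e \<in> edges G. ends G e \<subseteq> S}) = Suc (card {e \<in> edges G. ends G e \<subseteq> S})"
        using finE e y by (intro card_insert_disjoint) auto
      ultimately have "good (insert y S)"
        using S y finS adj_verts[OF fin \<open>adj G x y\<close>] by (auto simp: good_def)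
      then show False using max[of "insert y S"] y finS by simp
    qed
  qed
  then have "S = verts G" using S by (auto simp: good_def)
  moreover have "{e \<in> edges G. ends G e \<subseteq> verts G} = edges G" using fin by (auto simp: fin_graph_def)
  ultimately show ?thesis using S by (simp add: good_def)
qed simp

lemma handshake:
  assumes "fin_graph G"
  shows "(\<Sum>v\<in>verts G. vdegree G v) = 2 * card (edges G)"
proof -
  have fin: "finite (verts G)" "finite (edges G)" using assms by (auto simp: fin_graph_def)
  have "(\<Sum>v\<in>verts G. vdegree G v) = (\<Sum>v\<in>verts G. \<Sum>e\<in>edges G. if v \<in> ends G e then 1 else 0)"
    using fin by (simp add: vdegree_def sum.If_cases Int_def)
  also have "\<dots> = (\<Sum>e\<in>edges G. \<Sum>v\<in>verts G. if v \<in> ends G e then 1 else 0)" by (rule sum.swap)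
  also have "\<dots> = (\<Sum>e\<in>edges G. 2)"
  proof (rule sum.cong)
    fix e assume "e \<in> edges G"
    then have "verts G \<inter> ends G e = ends G e" "card (ends G e) = 2"
      using assms by (auto simp: fin_graph_def)
    then show "(\<Sum>v\<in>verts G. if v \<in> ends G e then 1 else 0) = (2::nat)"
      using fin by (simp add: sum.If_cases)
  qed simp
  finally show ?thesis by simp
qed

lemma tree_edge_count:
  assumes "is_tree T"
  shows "card (verts T) = card (edges T) + 1"
proof -
  have fin: "fin_graph T" and "verts T \<noteq> {}" using assms by (auto simp: is_tree_def)
  then have "card {e \<in> edges T. ends T e \<subseteq> verts T} < card (verts T)"
    using assms by (intro forest_edge_bound) (auto simp: is_tree_def)
  moreover have "{e \<in> edges T. ends T e \<subseteq> verts T} = edges T" using fin by (auto simp: fin_graph_def)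
  moreover have "card (verts T) \<le> card (edges T) + 1"
    using assms connected_edge_bound by (auto simp: is_tree_def)
  ultimately show ?thesis by simp
qed

text \<open>\<open>C\<close> is the component of \<open>u\<close> after deletion of
  \<open>e\<close>. If it contained \<open>w\<close>, the graph without \<open>e\<close> would still
  be connected, with fewer edges than \<open>connected_edge_bound\<close> demands.\<close>

lemma tree_edge_cut:
  assumes T: "is_tree T" and e: "e \<in> edges T" "ends T e = {u, w}"
  obtains C where "C \<subseteq> verts T" "u \<in> C" "w \<notin> C"
    "\<And>f x y. f \<in> edges T \<Longrightarrow> ends T f = {x, y} \<Longrightarrow> x \<in> C \<Longrightarrow> y \<notin> C \<Longrightarrow> f = e"
proof -
  have fin: "fin_graph T" using T by (simp add: is_tree_def)
  have uw: "u \<in> verts T" "w \<in> verts T" using e fin by (auto simp: fin_graph_def)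
  let ?D = "del_edge T e"
  have finD: "fin_graph ?D" using fin by (auto simp: fin_graph_def del_edge_def)
  have adjD: "adj T x y \<Longrightarrow> adj ?D x y \<or> {x, y} = {u, w}" for x y
    using e(2) by (auto simp: adj_def del_edge_def)
  define C where "C = {v. (adj ?D)\<^sup>*\<^sup>* u v}"
  have closed: "x \<in> C \<Longrightarrow> adj ?D x y \<Longrightarrow> y \<in> C" for x y
    unfolding C_def by (auto intro: rtranclp.rtrancl_into_rtrancl)
  have "C \<subseteq> verts T"
  proof
    fix v assume "v \<in> C"
    then have "(adj ?D)\<^sup>*\<^sup>* u v" by (simp add: C_def)
    then show "v \<in> verts T"
      by induction (use uw adj_verts(2)[OF finD] in \<open>auto simp: del_edge_def\<close>)
  qed
  moreover have "u \<in> C" by (simp add: C_def)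
  moreover have "w \<notin> C"
  proof
    assume "w \<in> C"
    have "verts T \<subseteq> C"
    proof (rule connected_closed[of T u])
      fix x y assume "x \<in> C" "adj T x y"
      then show "y \<in> C" using adjD[of x y] closed \<open>u \<in> C\<close> \<open>w \<in> C\<close>
        by (metis doubleton_eq_iff)
    qed (use T uw \<open>u \<in> C\<close> in \<open>auto simp: is_tree_def\<close>)
    then have "(adj ?D)\<^sup>*\<^sup>* u v" if "v \<in> verts T" for v using that by (auto simp: C_def)
    moreover have "(adj ?D)\<^sup>*\<^sup>* v u" if "(adj ?D)\<^sup>*\<^sup>* u v" for v
      using that by induction (auto intro: converse_rtranclp_into_rtranclp adj_sym)
    ultimately have "connected_graph ?D"
      unfolding connected_graph_adj by (metis del_edge_def mgraph.select_convs(1) mgraph.update_convs(2) mgraph.surjective rtranclp_trans)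
    then have "card (verts T) \<le> card (edges T - {e}) + 1"
      using connected_edge_bound[OF finD] by (simp add: del_edge_def)
    moreover have "card (edges T - {e}) < card (edges T)"
      using fin e by (intro card_Diff1_less) (auto simp: fin_graph_def)
    ultimately show False using tree_edge_count[OF T] by simp
  qed
  moreover have "f = e" if f: "f \<in> edges T" "ends T f = {x, y}" "x \<in> C" "y \<notin> C" for f x y
  proof (rule ccontr)
    assume "f \<noteq> e"
    then have "adj ?D x y" using f by (auto simp: adj_def del_edge_def)
    then show False using closed f by blast
  qed
  ultimately show ?thesis using that by blast
qed

text \<open>A parallel edge would be a second edge across the cut belonging to
  \<open>e\<close>.\<close>

lemma tree_parallel_edges:
  assumes T: "is_tree T" and e: "e \<in> edges T" "f \<in> edges T" "ends T e = ends T f"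
  shows "e = f"
proof -
  have "card (ends T e) = 2" using T e by (simp add: is_tree_def fin_graph_def)
  then obtain u w where uw: "ends T e = {u, w}" by (auto simp: card_2_iff)
  from tree_edge_cut[OF T e(1) uw] show ?thesis using e uw by metis
qed

text \<open>Agreement of two proper colourings does not change along an edge. This will show that
  traces following a 2-colouring of the tree belong to a single colour class of the large
  graph.\<close>

lemma proper_colouring_unique:
  assumes con: "connected_graph G" and fin: "fin_graph G"
    and c: "proper_colouring G c" "proper_colouring G d"
  shows "(\<forall>v\<in>verts G. c v = d v) \<or> (\<forall>v\<in>verts G. c v \<noteq> d v)"
proof (cases "verts G = {}")
  case False
  then obtain u where u: "u \<in> verts G" by blast
  have "verts G \<subseteq> {v. (c v = d v) = (c u = d u)}"
    by (rule connected_closed[OF con u]) (use c in \<open>auto simp: proper_colouring_def adj_def\<close>)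
  then show ?thesis by blast
qed simp

subsection \<open>Independent sets in trees with large inner degrees\<close>

definition indep :: "('v, 'e) mgraph \<Rightarrow> 'v set \<Rightarrow> bool" where
  "indep G S \<longleftrightarrow> (\<forall>u\<in>S. \<forall>v\<in>S. \<not> adj G u v)"

text \<open>Exclusion of \<open>K2\<close> enters as \<open>inner_nonempty\<close>; the restriction
  on stars is added in \<open>wide_tree\<close>.\<close>

locale thick_tree =
  fixes k :: nat and T :: "('a, 'b) mgraph"
  assumes k_pos: "1 \<le> k"
    and tree: "is_tree T"
    and inner_degree: "\<And>v. v \<in> verts T - leaves T \<Longrightarrow> k + 2 \<le> vdegree T v"
    and inner_nonempty: "verts T - leaves T \<noteq> {}"
begin

abbreviation "L \<equiv> leaves T"
abbreviation "I \<equiv> verts T - leaves T"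

lemma fin: "fin_graph T" and con: "connected_graph T"
  using tree by (auto simp: is_tree_def)

lemma leaves_subset: "L \<subseteq> verts T"
  by (auto simp: leaves_def verts_of_degree_def)

lemma finite_verts: "finite (verts T)" "finite L" "finite I" "finite (edges T)"
  using fin leaves_subset by (auto simp: fin_graph_def intro: finite_subset)

lemma adj_in_verts: "adj T u v \<Longrightarrow> u \<in> verts T \<and> v \<in> verts T \<and> u \<noteq> v"
  using adj_verts[OF fin] by blast

lemma leaf_edge:
  assumes "x \<in> L"
  obtains e p where "e \<in> edges T" "ends T e = {x, p}" "p \<in> I"
    "{e \<in> edges T. x \<in> ends T e} = {e}" "\<And>q. adj T x q \<longleftrightarrow> q = p"
proof -
  have "card {e \<in> edges T. x \<in> ends T e} = 1"
    using assms by (simp add: leaves_def verts_of_degree_def vdegree_def)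
  then obtain e where e: "{e \<in> edges T. x \<in> ends T e} = {e}" by (auto simp: card_1_singleton_iff)
  then have eT: "e \<in> edges T" "x \<in> ends T e" by auto
  obtain p where p: "ends T e = {x, p}" "p \<noteq> x" "adj T x p" by (rule incident_edge[OF fin eT])
  have nbr: "adj T x q \<longleftrightarrow> q = p" for q
  proof
    assume "adj T x q"
    then obtain f where "f \<in> edges T" "ends T f = {x, q}" by (auto simp: adj_def)
    then have "f = e" using e by blast
    then show "q = p" using \<open>ends T f = {x, q}\<close> p by (auto simp: doubleton_eq_iff)
  qed (use p in simp)
  \<comment> \<open>Two adjacent leaves have no further neighbours, so they would be the whole
    connected tree and leave no inner vertex.\<close>
  have "p \<in> I"
  proof (rule ccontr)
    assume "p \<notin> I"
    then have "p \<in> L" using adj_in_verts p by blast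
    then have "card {e \<in> edges T. p \<in> ends T e} = 1"
      by (simp add: leaves_def verts_of_degree_def vdegree_def)
    then obtain f where f: "{e \<in> edges T. p \<in> ends T e} = {f}" by (auto simp: card_1_singleton_iff)
    moreover have "e \<in> {e \<in> edges T. p \<in> ends T e}" using eT p by simp
    ultimately have "f = e" by simp
    have "verts T \<subseteq> {x, p}"
    proof (rule connected_closed[OF con])
      fix u v assume "u \<in> {x, p}" "adj T u v"
      then obtain g where g: "g \<in> edges T" "ends T g = {u, v}" by (auto simp: adj_def)
      then have "g = e" using \<open>u \<in> {x, p}\<close> e f \<open>f = e\<close> by blast
      then show "v \<in> {x, p}" using g p by blast
    qed (use assms leaves_subset in auto)
    then show False using inner_nonempty \<open>p \<in> L\<close> assms by blast
  qed
  then show ?thesis using that eT p e nbr by blast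
qed

lemma leaf_adj_inner: "x \<in> L \<Longrightarrow> adj T x q \<Longrightarrow> q \<in> I"
  by (metis leaf_edge)

text \<open>By independence the at least (k + 2) |Y| edges at \<open>Y\<close> are counted once
  each. They all lie within \<open>Y \<union> N\<close>, where a forest has fewer than |Y| + |N|
  edges.\<close>

lemma expansion:
  assumes Y: "Y \<subseteq> I" "Y \<noteq> {}" "indep T Y"
  shows "(k + 1) * card Y + 1 \<le> card {v. \<exists>y\<in>Y. adj T y v}"
proof -
  define N where "N = {v. \<exists>y\<in>Y. adj T y v}"
  define E where "E y = {e \<in> edges T. y \<in> ends T e}" for y
  have finY: "finite Y" and finN: "finite N"
    using Y finite_verts finite_subset[of N "verts T"] finite_subset[of Y I] adj_in_verts
    by (auto simp: N_def)
  have "(k + 2) * card Y \<le> (\<Sum>y\<in>Y. card (E y))"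
    using Y inner_degree sum_bounded_below[of Y "k + 2" "\<lambda>y. card (E y)"]
    by (auto simp: E_def vdegree_def subset_iff mult.commute)
  also have "\<dots> = card (\<Union>y\<in>Y. E y)"
  proof (rule card_UN_disjoint[symmetric])
    have "y = z" if "y \<in> Y" "z \<in> Y" "e \<in> E y" "e \<in> E z" for y z e
    proof -
      have e: "e \<in> edges T" "y \<in> ends T e" "z \<in> ends T e" using that by (auto simp: E_def)
      obtain u where "ends T e = {y, u}" "adj T y u" using incident_edge[OF fin e(1,2)] by metis
      then show ?thesis using e(3) that Y(3) by (auto simp: indep_def)
    qed
    then show "\<forall>y\<in>Y. \<forall>z\<in>Y. y \<noteq> z \<longrightarrow> E y \<inter> E z = {}" by blast
  qed (use finY finite_verts in \<open>auto simp: E_def\<close>)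
  also have "\<dots> \<le> card {e \<in> edges T. ends T e \<subseteq> Y \<union> N}"
  proof (rule card_mono)
    show "(\<Union>y\<in>Y. E y) \<subseteq> {e \<in> edges T. ends T e \<subseteq> Y \<union> N}"
    proof
      fix e assume "e \<in> (\<Union>y\<in>Y. E y)"
      then obtain y where y: "y \<in> Y" "e \<in> edges T" "y \<in> ends T e" by (auto simp: E_def)
      obtain u where "ends T e = {y, u}" "adj T y u" using incident_edge[OF fin y(2,3)] by metis
      then show "e \<in> {e \<in> edges T. ends T e \<subseteq> Y \<union> N}" using y by (auto simp: N_def)
    qed
  qed (use finite_verts in simp)
  also have "\<dots> < card (Y \<union> N)"
    using Y adj_in_verts tree fin by (intro forest_edge_bound) (auto simp: N_def is_tree_def)
  also have "\<dots> \<le> card Y + card N" by (rule card_Un_le)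
  finally show ?thesis by (simp add: N_def algebra_simps)
qed

lemma mixed_copy_small:
  assumes "Z \<subseteq> I" "P \<subseteq> L" "Q \<subseteq> L" "P \<inter> Q = {}" "W \<union> W' = I" "W \<inter> W' = {}"
    and ZP: "indep T (Z \<union> P)" and WQ: "indep T (W' \<union> Q)" and mixed: "Z \<inter> W' \<noteq> {}"
  shows "card Z + card P + card Q + k \<le> card W + card L"
proof -
  define Y where "Y = Z \<inter> W'"
  have fins: "finite Z" "finite W" "finite W'" "finite P" "finite Q"
    using assms finite_verts by (auto intro: finite_subset)
  have sub: "{v. \<exists>y\<in>Y. adj T y v} \<subseteq> (W - Z) \<union> (L - (P \<union> Q))"
  proof
    fix v assume "v \<in> {v. \<exists>y\<in>Y. adj T y v}"
    then obtain y where y: "y \<in> Z" "y \<in> W'" "adj T y v" by (auto simp: Y_def)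
    then have "v \<notin> Z \<union> P" "v \<notin> W' \<union> Q" using ZP WQ by (auto simp: indep_def)
    moreover have "v \<in> verts T" using y adj_in_verts by blast
    ultimately show "v \<in> (W - Z) \<union> (L - (P \<union> Q))" using assms(5) by blast
  qed
  have "(k + 1) * card Y + 1 \<le> card {v. \<exists>y\<in>Y. adj T y v}"
    using assms by (intro expansion) (auto simp: Y_def indep_def)
  also have "\<dots> \<le> card ((W - Z) \<union> (L - (P \<union> Q)))"
    using fins finite_verts sub by (intro card_mono) auto
  also have "\<dots> \<le> card (W - Z) + card (L - (P \<union> Q))" by (rule card_Un_le)
  finally have 1: "(k + 1) * card Y + 1 \<le> card (W - Z) + card (L - (P \<union> Q))" .
  have 2: "card (L - (P \<union> Q)) + card P + card Q = card L"
    using assms(2-4) fins finite_verts card_Un_disjoint[of P Q]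
      card_Diff_subset[of "P \<union> Q" L] card_mono[of L "P \<union> Q"] by auto
  have 3: "card (W - Z) + card (W \<inter> Z) = card W"
    using fins card_Int_Diff[of W Z] by simp
  have "card Z = card (Z \<inter> W' \<union> Z \<inter> W)" using assms(1,5) by (intro arg_cong[of _ _ card]) auto
  also have "\<dots> = card Y + card (W \<inter> Z)"
    using assms(6) fins by (subst card_Un_disjoint) (auto simp: Y_def Int_commute)
  finally have 4: "card Z = card Y + card (W \<inter> Z)" .
  have "card Y \<noteq> 0" using mixed fins by (simp add: Y_def)
  then have "k \<le> k * card Y" by simp
  moreover have "(k + 1) * card Y = k * card Y + card Y" by simp
  ultimately show ?thesis using 1 2 3 4 by linarith
qed

end

locale wide_tree = thick_tree +
  assumes star_leaves: "card (verts T - leaves T) = 1 \<Longrightarrow> 2 * k \<le> card (leaves T)"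
begin

lemma overlap_small:
  assumes W: "W \<subseteq> I" "W' \<subseteq> I" and PQ: "P \<subseteq> L" "Q \<subseteq> L" "P \<inter> Q = {}"
    and WP: "indep T (W \<union> P)" and WQ: "indep T (W' \<union> Q)" and overlap: "W \<inter> W' \<noteq> {}"
  shows "k * card W + k * card W' + card P + card Q + k \<le> k * card I + card L"
proof -
  define C where "C = W \<inter> W'"
  define R where "R = I - (W \<union> W')"
  have fins: "finite W" "finite W'" "finite P" "finite Q"
    using assms finite_verts by (auto intro: finite_subset)
  have sub: "{v. \<exists>y\<in>C. adj T y v} \<subseteq> R \<union> (L - (P \<union> Q))"
  proof
    fix v assume "v \<in> {v. \<exists>y\<in>C. adj T y v}"
    then obtain y where y: "y \<in> W" "y \<in> W'" "adj T y v" by (auto simp: C_def)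
    then have "v \<notin> W \<union> P" "v \<notin> W' \<union> Q" using WP WQ by (auto simp: indep_def)
    moreover have "v \<in> verts T" using y adj_in_verts by blast
    ultimately show "v \<in> R \<union> (L - (P \<union> Q))" by (auto simp: R_def)
  qed
  have "(k + 1) * card C + 1 \<le> card {v. \<exists>y\<in>C. adj T y v}"
    using assms by (intro expansion) (auto simp: C_def indep_def)
  also have "\<dots> \<le> card (R \<union> (L - (P \<union> Q)))"
    using fins finite_verts sub by (intro card_mono) (auto simp: R_def)
  also have "\<dots> \<le> card R + card (L - (P \<union> Q))" by (rule card_Un_le)
  finally have 1: "(k + 1) * card C + 1 \<le> card R + card (L - (P \<union> Q))" .
  have 2: "card (L - (P \<union> Q)) + (card P + card Q) = card L"
    using PQ fins finite_verts card_Un_disjoint[of P Q]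
      card_Diff_subset[of "P \<union> Q" L] card_mono[of L "P \<union> Q"] by auto
  have "card (W \<union> W') + card C = card W + card W'"
    unfolding C_def using card_Un_Int[OF fins(1,2)] by simp
  moreover have "card (W \<union> W') + card R = card I"
    unfolding R_def using W finite_verts card_Diff_subset[of "W \<union> W'" I] card_mono[of I "W \<union> W'"] fins by auto
  ultimately have "card W + card W' + card R = card I + card C" by simp
  then have "k * (card W + card W' + card R) = k * (card I + card C)" by simp
  then have 3: "k * card W + k * card W' + k * card R = k * card I + k * card C"
    by (simp add: algebra_simps)
  have C1: "1 \<le> card C" using overlap fins by (simp add: C_def Suc_le_eq card_gt_0_iff)
  show ?thesis
  proof (cases "R = {}")
    case False
    then have "1 \<le> card R" using finite_verts by (simp add: R_def Suc_le_eq card_gt_0_iff)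
    then obtain a b where "card R = Suc a" "k = Suc b" using k_pos by (metis Suc_le_D One_nat_def)
    \<comment> \<open>This is (k - 1) (|R| - 1) \<ge> 0.\<close>
    then have "k + card R \<le> k * card R + 1" by simp
    then show ?thesis using 1 2 3 C1 by (simp add: algebra_simps)
  next
    case True
    obtain v where v: "v \<in> C" using overlap by (auto simp: C_def)
    have "verts T \<subseteq> insert v {u. adj T v u}"
    proof (rule connected_closed[OF con])
      fix x y assume x: "x \<in> insert v {u. adj T v u}" and xy: "adj T x y"
      show "y \<in> insert v {u. adj T v u}"
      proof (cases "x = v")
        case False
        then have vx: "adj T v x" using x by simp
        then have "x \<in> L" using sub v True by blast
        then show ?thesis using vx xy adj_sym leaf_edge by (metis insertI1)
      qed (use xy in simp)
    qed (use v W in \<open>auto simp: C_def\<close>)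
    moreover have "{u. adj T v u} \<subseteq> L - (P \<union> Q)" using sub v True by auto
    moreover have "v \<in> I" using v W by (auto simp: C_def)
    ultimately have "I = {v}" "P = {}" "Q = {}"
      using PQ leaves_subset by blast+
    moreover have "W \<subseteq> {v}" "W' \<subseteq> {v}" using W \<open>I = {v}\<close> by auto
    then have "card W \<le> 1" "card W' \<le> 1" by (auto dest: card_mono[rotated])
    then have "k * card W \<le> k" "k * card W' \<le> k" by auto
    ultimately have "card I = 1" "k * card W \<le> k" "k * card W' \<le> k" "P = {}" "Q = {}" by auto
    moreover from this have "card L \<ge> 2 * k" "k * card I = k" "card P = 0" "card Q = 0"
      using star_leaves by simp_all
    ultimately show ?thesis by linarith
  qed
qed

text \<open>The only neighbour of a leaf is inner, so each leaf can take the colour opposite to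
  it.\<close>

lemma inner_colouring_extends:
  assumes "W \<union> W' = I" "W \<inter> W' = {}" "indep T W" "indep T W'"
  shows "proper_colouring T (\<lambda>v. v \<in> W \<union> {x \<in> L. \<exists>p\<in>W'. adj T x p})"
  unfolding proper_colouring_def
proof (intro ballI allI impI)
  define F where "F = W \<union> {x \<in> L. \<exists>p\<in>W'. adj T x p}"
  have leaf: "(x \<in> F) \<noteq> (y \<in> F)" if "x \<in> L" "adj T x y" for x y
  proof -
    have y: "y \<in> I" and "\<And>q. adj T x q \<longleftrightarrow> q = y"
      using that by (metis leaf_edge)+
    then have "x \<in> F \<longleftrightarrow> y \<in> W'" using that(1) assms(1) by (auto simp: F_def)
    moreover have "y \<in> F \<longleftrightarrow> y \<notin> W'" using y assms(1,2) by (auto simp: F_def)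
    ultimately show ?thesis by blast
  qed
  fix e u v assume "e \<in> edges T" "ends T e = {u, v}"
  then have uv: "adj T u v" by (auto simp: adj_def)
  have "(u \<in> F) \<noteq> (v \<in> F)"
  proof (cases "u \<in> L \<or> v \<in> L")
    case True
    then show ?thesis using leaf uv adj_sym by metis
  next
    case False
    then have "u \<in> I" "v \<in> I" using adj_in_verts uv by auto
    then show ?thesis using assms uv adj_sym[OF uv] unfolding F_def indep_def by blast
  qed
  then show "(u \<in> W \<union> {x \<in> L. \<exists>p\<in>W'. adj T x p}) \<noteq> (v \<in> W \<union> {x \<in> L. \<exists>p\<in>W'. adj T x p})"
    by (simp add: F_def)
qed

lemma sum_le_mult_max:
  assumes "\<And>i. i < n \<Longrightarrow> f i \<le> (a :: nat)"
  shows "(\<Sum>i<n. f i) \<le> n * a"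
  using assms sum_bounded_above[of "{..<n}" f a] by simp

text \<open>The term of copy \<open>j\<close> is kept apart, so that a deficit in this single copy
  survives the summation.\<close>

lemma sum_le_mult_max_other:
  assumes "\<And>i. i < n \<Longrightarrow> f i \<le> (a :: nat)" and j: "j < n"
  shows "(\<Sum>i<n. f i) + a \<le> n * a + f j"
proof -
  have "(\<Sum>i<n. f i) = f j + (\<Sum>i\<in>{..<n} - {j}. f i)" using j by (simp add: sum.remove)
  also have "\<dots> \<le> f j + (n - 1) * a"
    using assms sum_bounded_above[of "{..<n} - {j}" f a] j by simp
  finally show "(\<Sum>i<n. f i) + a \<le> n * a + f j"
    using j by (cases n) auto
qed

text \<open>
  In one side of the glued graph an independent set traces out the sets \<open>Z i\<close> of inner vertices
  of the copies and a set \<open>P\<close> of leaves, in the other side \<open>Z' i\<close> and \<open>Q\<close>.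
\<close>

lemma independent_traces:
  assumes Z: "\<And>i. i < k \<Longrightarrow> Z i \<subseteq> I" "\<And>i. i < k \<Longrightarrow> Z' i \<subseteq> I"
    and PQ: "P \<subseteq> L" "Q \<subseteq> L" "P \<inter> Q = {}"
    and ZP: "\<And>i. i < k \<Longrightarrow> indep T (Z i \<union> P)" and ZQ: "\<And>i. i < k \<Longrightarrow> indep T (Z' i \<union> Q)"
  shows "(\<Sum>i<k. card (Z i)) + (\<Sum>i<k. card (Z' i)) + card P + card Q + k \<le> k * card I + card L \<or>
    (\<exists>F. proper_colouring T (\<lambda>v. v \<in> F) \<and> (\<forall>i<k. Z i \<union> P \<subseteq> F \<and> (Z' i \<union> Q) \<inter> F = {}))"
proof -
  have max: "\<exists>m<k. \<forall>i<k. card (X i) \<le> card (X m)" for X :: "nat \<Rightarrow> 'a set"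
  proof -
    have "{..<k} \<noteq> {}" using k_pos by (simp add: lessThan_empty_iff)
    then have "Max ((\<lambda>i. card (X i)) ` {..<k}) \<in> (\<lambda>i. card (X i)) ` {..<k}" by (intro Max_in) auto
    then obtain m where "m < k" "card (X m) = Max ((\<lambda>i. card (X i)) ` {..<k})" by auto
    then show ?thesis by (metis Max_ge finite_imageI finite_lessThan imageI lessThan_iff)
  qed
  obtain m where m: "m < k" "\<And>i. i < k \<Longrightarrow> card (Z i) \<le> card (Z m)" using max[of Z] by blast
  obtain m' where m': "m' < k" "\<And>i. i < k \<Longrightarrow> card (Z' i) \<le> card (Z' m')" using max[of Z'] by blast
  define W where "W = Z m"
  define W' where "W' = Z' m'"
  have leW: "card (Z i) \<le> card W" "card (Z' i) \<le> card W'" if "i < k" for i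
    using m(2) m'(2) that by (simp_all add: W_def W'_def)
  have sumZ: "(\<Sum>i<k. card (Z i)) \<le> k * card W"
    "\<And>j. j < k \<Longrightarrow> (\<Sum>i<k. card (Z i)) + card W \<le> k * card W + card (Z j)"
    using leW(1) by (blast intro: sum_le_mult_max sum_le_mult_max_other)+
  have sumZ': "(\<Sum>i<k. card (Z' i)) \<le> k * card W'"
    "\<And>j. j < k \<Longrightarrow> (\<Sum>i<k. card (Z' i)) + card W' \<le> k * card W' + card (Z' j)"
    using leW(2) by (blast intro: sum_le_mult_max sum_le_mult_max_other)+
  have W: "W \<subseteq> I" "W' \<subseteq> I" "indep T (W \<union> P)" "indep T (W' \<union> Q)"
    using Z ZP ZQ m(1) m'(1) by (auto simp: W_def W'_def)
  have fins: "finite W" "finite W'" using W finite_verts by (auto intro: finite_subset)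
  have cPQ: "card P + card Q \<le> card L"
    using PQ finite_verts card_Un_disjoint[of P Q] card_mono[of L "P \<union> Q"]
      finite_subset[of P L] finite_subset[of Q L] by auto
  consider (few) "card W + card W' + 1 \<le> card I" | (overlap) "W \<inter> W' \<noteq> {}"
    | (part) "card I \<le> card W + card W'" "W \<inter> W' = {}" by linarith
  then show ?thesis
  proof cases
    case few
    \<comment> \<open>One inner vertex missing from the two largest traces is missing once per copy,
      and this already supplies the slack \<open>k\<close>.\<close>
    then have "k * (card W + card W' + 1) \<le> k * card I" by (intro mult_le_mono2)
    then show ?thesis using sumZ(1) sumZ'(1) cPQ by (simp add: algebra_simps)
  next
    case overlap
    then show ?thesis
      using overlap_small[OF W(1,2) PQ W(3,4)] sumZ(1) sumZ'(1) by linarith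
  next
    case part
    have "card (W \<union> W') = card W + card W'" using part(2) fins by (rule card_Un_disjoint[rotated 2])
    then have un: "W \<union> W' = I" using part(1) W(1,2) finite_verts by (intro card_seteq) auto
    have cI: "k * card I = k * card W + k * card W'"
      using \<open>card (W \<union> W') = _\<close> un by (simp add: algebra_simps)
    show ?thesis
    \<comment> \<open>Either every trace respects the partition of the inner vertices, which then
      extends to a 2-colouring of the tree containing the leaves \<open>P\<close> and avoiding
      \<open>Q\<close>, or one trace \<open>j\<close> crosses it and \<open>mixed_copy_small\<close>
      applies to that copy.\<close>
    proof (cases "\<forall>i<k. Z i \<inter> W' = {} \<and> Z' i \<inter> W = {}")
      case True
      define F where "F = W \<union> {x \<in> L. \<exists>p\<in>W'. adj T x p}"
      have "proper_colouring T (\<lambda>v. v \<in> F)"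
        unfolding F_def using un part(2) W(3,4) by (intro inner_colouring_extends) (auto simp: indep_def)
      moreover have "Z i \<subseteq> F" if "i < k" for i using that Z(1) True un by (fastforce simp: F_def)
      moreover have "Z' i \<inter> F = {}" if "i < k" for i using that Z(2) True by (fastforce simp: F_def)
      moreover have "P \<subseteq> F"
      proof
        fix x assume x: "x \<in> P"
        then obtain p where p: "p \<in> I" "adj T x p" using PQ(1) leaf_edge by (metis subsetD)
        then have "p \<notin> W" using W(3) x by (auto simp: indep_def)
        then show "x \<in> F" using p un x PQ(1) by (auto simp: F_def)
      qed
      moreover have "Q \<inter> F = {}" using W(1,4) PQ(2) by (auto simp: F_def indep_def)
      ultimately show ?thesis by blast
    next
      case False
      then consider j where "j < k" "Z j \<inter> W' \<noteq> {}" | j where "j < k" "Z' j \<inter> W \<noteq> {}" by blast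
      then show ?thesis
      proof cases
        case 1
        have "card (Z j) + card P + card Q + k \<le> card W + card L"
          using 1 Z(1) ZP PQ un part(2) W(4) by (intro mixed_copy_small[where W' = W']) auto
        then show ?thesis using sumZ(2)[OF 1(1)] sumZ'(1) cI by linarith
      next
        case 2
        have "card (Z' j) + card Q + card P + k \<le> card W' + card L"
          using 2 Z(2) ZQ PQ un part(2) W(3) by (intro mixed_copy_small[where W' = W]) auto
        then show ?thesis using sumZ'(2)[OF 2(1)] sumZ(1) cI by linarith
      qed
    qed
  qed
qed

end

subsection \<open>The graph obtained by leaf matching\<close>

text \<open>
  \<open>h s i v\<close> is copy number \<open>i\<close> of the vertex \<open>v\<close> in \<open>H\<close> (\<open>s = False\<close>) or \<open>H'\<close> (\<open>s = True\<close>),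
  \<open>\<epsilon> s i e\<close> the corresponding copy of the edge \<open>e\<close>, and \<open>\<mu> x\<close> the matching edge at the leaf \<open>x\<close>.
\<close>

locale leaf_matched = wide_tree k T
  for k :: nat and T :: "('a, 'b) mgraph" +
  fixes G :: "('v, 'e) mgraph"
    and h :: "bool \<Rightarrow> nat \<Rightarrow> 'a \<Rightarrow> 'v" and \<epsilon> :: "bool \<Rightarrow> nat \<Rightarrow> 'b \<Rightarrow> 'e" and \<mu> :: "'a \<Rightarrow> 'e"
  assumes fin_G: "fin_graph G"
    and h_eq: "\<And>s t i j u v. i < k \<Longrightarrow> j < k \<Longrightarrow> u \<in> verts T \<Longrightarrow> v \<in> verts T \<Longrightarrow>
      h s i u = h t j v \<longleftrightarrow> s = t \<and> u = v \<and> (i = j \<or> u \<in> leaves T)"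
    and verts_G: "verts G = {h s i v | s i v. i < k \<and> v \<in> verts T}"
    and edges_G: "edges G = {\<epsilon> s i e | s i e. i < k \<and> e \<in> edges T} \<union> \<mu> ` leaves T"
    and eps_eq: "\<And>s t i j e f. i < k \<Longrightarrow> j < k \<Longrightarrow> e \<in> edges T \<Longrightarrow> f \<in> edges T \<Longrightarrow>
      \<epsilon> s i e = \<epsilon> t j f \<longleftrightarrow> s = t \<and> i = j \<and> e = f"
    and mu_inj: "inj_on \<mu> (leaves T)"
    and eps_mu: "\<And>s i e x. i < k \<Longrightarrow> e \<in> edges T \<Longrightarrow> x \<in> leaves T \<Longrightarrow> \<epsilon> s i e \<noteq> \<mu> x"
    and ends_eps: "\<And>s i e. i < k \<Longrightarrow> e \<in> edges T \<Longrightarrow> ends G (\<epsilon> s i e) = h s i ` ends T e"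
    and ends_mu: "\<And>x. x \<in> leaves T \<Longrightarrow> ends G (\<mu> x) = {h False 0 x, h True 0 x}"
begin

lemma k0: "0 < k" using k_pos by simp

lemma h_leaf: "x \<in> L \<Longrightarrow> i < k \<Longrightarrow> j < k \<Longrightarrow> h s i x = h s j x"
  using leaves_subset by (subst h_eq) auto

lemma eps_edge: "i < k \<Longrightarrow> e \<in> edges T \<Longrightarrow> \<epsilon> s i e \<in> edges G"
  and mu_edge: "x \<in> L \<Longrightarrow> \<mu> x \<in> edges G"
  by (auto simp: edges_G)

lemma h_in_verts: "i < k \<Longrightarrow> v \<in> verts T \<Longrightarrow> h s i v \<in> verts G"
  by (auto simp: verts_G)

lemma edge_cases:
  assumes "d \<in> edges G"
  obtains (tree_edge) s i e where "i < k" "e \<in> edges T" "d = \<epsilon> s i e"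
    | (leaf_edge) x where "x \<in> L" "d = \<mu> x"
  using assms by (auto simp: edges_G)

lemma tree_edge_ends:
  assumes "e \<in> edges T"
  obtains u v where "ends T e = {u, v}" "u \<noteq> v" "u \<in> verts T" "v \<in> verts T" "adj T u v"
proof -
  have "card (ends T e) = 2" "ends T e \<subseteq> verts T" using assms fin by (auto simp: fin_graph_def)
  then obtain u v where "ends T e = {u, v}" "u \<noteq> v" "u \<in> verts T" "v \<in> verts T"
    by (auto simp: card_2_iff)
  then show ?thesis using that assms by (auto simp: adj_def)
qed

lemma adj_copy: "adj T u v \<Longrightarrow> i < k \<Longrightarrow> adj G (h s i u) (h s i v)"
  unfolding adj_def using eps_edge ends_eps by fastforce

lemma adj_leaves:
  assumes "x \<in> L" "i < k" "j < k"
  shows "adj G (h s i x) (h (\<not> s) j x)"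
proof -
  have "ends G (\<mu> x) = {h s i x, h (\<not> s) j x}"
    using ends_mu[OF assms(1)] h_leaf[OF assms(1) assms(2) k0, of s] h_leaf[OF assms(1) assms(3) k0, of "\<not> s"]
    by (cases s) auto
  then show ?thesis unfolding adj_def using mu_edge assms(1) by blast
qed

lemma leaves_nonempty: "L \<noteq> {}"
proof
  assume "L = {}"
  then have "(k + 2) * card (verts T) \<le> (\<Sum>v\<in>verts T. vdegree T v)"
    using inner_degree sum_bounded_below[of "verts T" "k + 2" "vdegree T"] by (simp add: mult.commute)
  also have "\<dots> = 2 * card (edges T)" by (rule handshake[OF fin])
  finally have "2 * card (verts T) \<le> 2 * card (edges T)" by (simp add: algebra_simps)
  then show False using tree_edge_count[OF tree] by simp
qed

lemma connected_G: "connected_graph G"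
proof -
  obtain x where x: "x \<in> L" using leaves_nonempty by blast
  define r where "r = h False 0 x"
  have copy: "(adj G)\<^sup>*\<^sup>* (h s i u) (h s i v)" if "(adj T)\<^sup>*\<^sup>* u v" "i < k" for s i u v
    using that(1)
  proof induction
    case (step y z)
    then show ?case using adj_copy[OF step.hyps(2) that(2)] by (metis rtranclp.rtrancl_into_rtrancl)
  qed simp
  have from_r: "(adj G)\<^sup>*\<^sup>* r a" if aG: "a \<in> verts G" for a
  proof -
    obtain s i v where a: "i < k" "v \<in> verts T" "a = h s i v" using aG by (auto simp: verts_G)
    have "(adj G)\<^sup>*\<^sup>* r (h s i x)"
      using adj_leaves[OF x k0 a(1), of False] h_leaf[OF x a(1) k0, of False]
      by (cases s) (auto simp: r_def)
    moreover have "(adj T)\<^sup>*\<^sup>* x v" using con a(2) x leaves_subset by (auto simp: connected_graph_adj)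
    ultimately show ?thesis using copy a by (metis rtranclp_trans)
  qed
  have "(adj G)\<^sup>*\<^sup>* b a" if "(adj G)\<^sup>*\<^sup>* a b" for a b
    using that by induction (auto intro: converse_rtranclp_into_rtranclp adj_sym)
  then show ?thesis unfolding connected_graph_adj using from_r by (metis rtranclp_trans)
qed

text \<open>All copies of a leaf on one side coincide, so leaves are counted through copy 0 and only
  inner vertices are counted per copy.\<close>

lemma card_split:
  assumes "Z \<subseteq> verts G"
  shows "card Z = (\<Sum>i<k. card {v \<in> I. h False i v \<in> Z}) + card {x \<in> L. h False 0 x \<in> Z} +
    ((\<Sum>i<k. card {v \<in> I. h True i v \<in> Z}) + card {x \<in> L. h True 0 x \<in> Z})"
proof -
  define D where "D s = (SIGMA i:{..<k}. {v \<in> I. h s i v \<in> Z}) \<union> {0} \<times> {x \<in> L. h s 0 x \<in> Z}" for s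
  have D: "i < k \<and> v \<in> verts T \<and> h s i v \<in> Z \<and> (v \<in> L \<longrightarrow> i = 0)" if "(i, v) \<in> D s" for s i v
    using that k0 leaves_subset by (auto simp: D_def)
  have cardD: "card (D s) = (\<Sum>i<k. card {v \<in> I. h s i v \<in> Z}) + card {x \<in> L. h s 0 x \<in> Z}" for s
    unfolding D_def using finite_verts
    by (subst card_Un_disjoint) (auto simp: card_cartesian_product)
  have finD: "finite (D s)" for s unfolding D_def using finite_verts by auto
  have inj: "inj_on (\<lambda>(i, v). h s i v) (D s)" for s
    by (rule inj_onI) (use D h_eq in \<open>auto; metis\<close>)
  have "Z = (\<lambda>(i, v). h False i v) ` D False \<union> (\<lambda>(i, v). h True i v) ` D True" (is "_ = ?F \<union> ?T")
  proof
    show "Z \<subseteq> ?F \<union> ?T"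
    proof
      fix z assume z: "z \<in> Z"
      then obtain s i v where v: "i < k" "v \<in> verts T" "z = h s i v" using assms by (auto simp: verts_G)
      have "\<exists>j. (j, v) \<in> D s \<and> z = h s j v"
      proof (cases "v \<in> L")
        case True
        then have "z = h s 0 v" using v h_leaf k0 by metis
        then show ?thesis using True z by (auto simp: D_def)
      qed (use v z in \<open>auto simp: D_def\<close>)
      then show "z \<in> ?F \<union> ?T" by (cases s) force+
    qed
  qed (use D in auto)
  moreover have "?F \<inter> ?T = {}"
  proof -
    have "h False i u \<noteq> h True j v" if "(i, u) \<in> D False" "(j, v) \<in> D True" for i j u v
      using D[OF that(1)] D[OF that(2)] by (simp add: h_eq)
    then show ?thesis by auto
  qed
  ultimately have "card Z = card ?F + card ?T" using finD by (simp add: card_Un_disjoint)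
  then show ?thesis using inj cardD by (simp add: card_image)
qed

section \<open>The colour classes of the graph and expansion of independent sets\<close>

definition col :: "'a \<Rightarrow> bool" where
  "col = (SOME c. proper_colouring T c)"

lemma proper_col: "proper_colouring T col"
  unfolding col_def
  by (rule someI_ex[of "proper_colouring T"], rule forest_colouring[OF fin])
    (use tree in \<open>auto simp: is_tree_def\<close>)

lemma col_adj: "adj T u v \<Longrightarrow> col u \<noteq> col v"
  using proper_col by (auto simp: proper_colouring_def adj_def)

text \<open>Testing \<open>col v = s\<close> reverses the colours of the tree on the side
  \<open>s = False\<close> relative to \<open>s = True\<close>. Hence the matching edge at a leaf
  joins different classes.\<close>

definition part :: "'a set \<Rightarrow> bool \<Rightarrow> 'v set" where
  "part C b = {h s i v | s i v. i < k \<and> v \<in> C \<and> (col v = s) = b}"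

lemma mem_part:
  assumes "C \<subseteq> verts T" "i < k" "v \<in> verts T"
  shows "h s i v \<in> part C b \<longleftrightarrow> v \<in> C \<and> (col v = s) = b"
proof
  assume "h s i v \<in> part C b"
  then obtain t j u where "h s i v = h t j u" "j < k" "u \<in> C" "(col u = t) = b" by (auto simp: part_def)
  then show "v \<in> C \<and> (col v = s) = b" using assms by (auto simp: h_eq subset_iff)
qed (use assms in \<open>auto simp: part_def\<close>)

lemma h_part: "i < k \<Longrightarrow> v \<in> verts T \<Longrightarrow> h s i v \<in> part (verts T) b \<or> h s i v \<in> part (verts T) (\<not> b)"
  by (auto simp: mem_part)

lemma part_subset: "C \<subseteq> verts T \<Longrightarrow> part C b \<subseteq> verts G"
  by (auto simp: part_def verts_G)

text \<open>The value does not depend on \<open>b\<close>: a vertex of \<open>C\<close> puts its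
  copies from one side into one class and those from the other side into the other. Every
  \<open>C\<close> is thus balanced, which serves both Hall's theorem and the cut argument.\<close>

lemma card_part:
  assumes C: "C \<subseteq> verts T"
  shows "card (part C b) = k * card (I \<inter> C) + card (L \<inter> C)"
proof -
  have split: "card {v \<in> S. v \<in> C \<and> (col v = False) = b} + card {v \<in> S. v \<in> C \<and> (col v = True) = b} = card (S \<inter> C)"
    if "finite S" for S
  proof -
    have eq: "S \<inter> C = {v \<in> S. v \<in> C \<and> (col v = False) = b} \<union> {v \<in> S. v \<in> C \<and> (col v = True) = b}" by auto
    show ?thesis
      unfolding eq using that by (intro card_Un_disjoint[symmetric]) auto
  qed
  have eqI: "{v \<in> I. h s i v \<in> part C b} = {v \<in> I. v \<in> C \<and> (col v = s) = b}" if "i < k" for s i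
    using mem_part[OF C that] by auto
  have eqL: "{v \<in> L. h s 0 v \<in> part C b} = {v \<in> L. v \<in> C \<and> (col v = s) = b}" for s
    using mem_part[OF C k0] leaves_subset by auto
  have sum: "(\<Sum>i<k. card {v \<in> I. h s i v \<in> part C b}) = k * card {v \<in> I. v \<in> C \<and> (col v = s) = b}" for s
    using eqI by simp
  have "card (part C b) = k * (card {v \<in> I. v \<in> C \<and> (col v = False) = b} + card {v \<in> I. v \<in> C \<and> (col v = True) = b}) +
    (card {v \<in> L. v \<in> C \<and> (col v = False) = b} + card {v \<in> L. v \<in> C \<and> (col v = True) = b})"
    unfolding card_split[OF part_subset[OF C]] sum eqL by (simp only: algebra_simps)
  then show ?thesis unfolding split[OF finite_verts(3)] split[OF finite_verts(2)] .
qed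

lemma card_side: "card (part (verts T) b) = k * card I + card L"
proof -
  have "I \<inter> verts T = I" "L \<inter> verts T = L" using leaves_subset by auto
  then show ?thesis using card_part[OF subset_refl, of b] by simp
qed

lemma sides_G: "sides G (part (verts T) b) (part (verts T) (\<not> b))"
  unfolding sides_def
proof (intro conjI ballI)
  note mem = mem_part[OF subset_refl]
  show "part (verts T) b \<union> part (verts T) (\<not> b) = verts G"
  proof
    show "verts G \<subseteq> part (verts T) b \<union> part (verts T) (\<not> b)"
      using h_part unfolding verts_G by blast
  qed (use part_subset[OF subset_refl] in blast)
  show "part (verts T) b \<inter> part (verts T) (\<not> b) = {}"
  proof -
    have "z \<notin> part (verts T) (\<not> b)" if z: "z \<in> part (verts T) b" for z
    proof -
      obtain s i v where "i < k" "v \<in> verts T" "z = h s i v" "(col v = s) = b"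
        using z by (auto simp: part_def)
      then show ?thesis using mem by auto
    qed
    then show ?thesis by blast
  qed
  fix d assume "d \<in> edges G"
  then have "\<exists>s t i j u v. ends G d = {h s i u, h t j v} \<and> i < k \<and> j < k \<and> u \<in> verts T \<and> v \<in> verts T \<and>
      (col u = s) \<noteq> (col v = t)"
  proof (cases rule: edge_cases)
    case (tree_edge s i e)
    obtain u v where "ends T e = {u, v}" "u \<in> verts T" "v \<in> verts T" "adj T u v"
      using tree_edge_ends[OF tree_edge(2)] by metis
    then have "ends G d = {h s i u, h s i v} \<and> i < k \<and> i < k \<and> u \<in> verts T \<and> v \<in> verts T \<and> (col u = s) \<noteq> (col v = s)"
      using tree_edge col_adj[of u v] ends_eps by auto
    then show ?thesis by blast
  next
    case (leaf_edge x)
    then have "ends G d = {h False 0 x, h True 0 x} \<and> 0 < k \<and> 0 < k \<and> x \<in> verts T \<and> x \<in> verts T \<and>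
        (col x = False) \<noteq> (col x = True)"
      using ends_mu k0 leaves_subset by auto
    then show ?thesis by blast
  qed
  then obtain s t i j u v where *: "ends G d = {h s i u, h t j v}" "i < k" "j < k" "u \<in> verts T" "v \<in> verts T"
    "(col u = s) \<noteq> (col v = t)" by blast
  show "\<exists>a\<in>part (verts T) b. \<exists>a'\<in>part (verts T) (\<not> b). ends G d = {a, a'}"
  proof (cases "(col u = s) = b")
    case True
    then have "h s i u \<in> part (verts T) b" "h t j v \<in> part (verts T) (\<not> b)"
      using *(2-6) by (simp_all add: mem)
    then show ?thesis using *(1) by blast
  next
    case False
    then have "h s i u \<in> part (verts T) (\<not> b)" "h t j v \<in> part (verts T) b"
      using *(2-6) by (auto simp: mem)
    then show ?thesis using *(1) by (metis insert_commute)
  qed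
qed

text \<open>The traces of \<open>X \<union> Y\<close> are handed to
  \<open>independent_traces\<close>; the leaf traces of the two sides are disjoint because of the
  matching edges. In the alternative with a 2-colouring, \<open>X \<union> Y\<close> would lie in
  one colour class although both parts are nonempty.\<close>

lemma expand_G:
  assumes X: "X \<subseteq> part (verts T) True" "X \<noteq> {}" and Y: "Y \<subseteq> part (verts T) False" "Y \<noteq> {}"
    and non: "\<And>x y. x \<in> X \<Longrightarrow> y \<in> Y \<Longrightarrow> \<not> adj G x y"
  shows "card X + card Y + k \<le> card (part (verts T) True)"
proof -
  define Z where "Z = X \<union> Y"
  note mem = mem_part[OF subset_refl]
  have disj: "part (verts T) True \<inter> part (verts T) False = {}"
    using sides_G[of True] by (simp add: sides_def)
  have ZV: "Z \<subseteq> verts G" using X Y part_subset[OF subset_refl] by (fastforce simp: Z_def)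
  have "finite (verts G)" using fin_G by (simp add: fin_graph_def)
  then have cZ: "card Z = card X + card Y" unfolding Z_def
    using ZV X(1) Y(1) disj by (intro card_Un_disjoint) (auto simp: Z_def intro: finite_subset)
  have opp: "(a \<in> X \<longrightarrow> b \<in> part (verts T) False) \<and> (a \<in> Y \<longrightarrow> b \<in> part (verts T) True)"
    if ab: "adj G a b" for a b
  proof -
    obtain d where "d \<in> edges G" "ends G d = {a, b}" using ab by (auto simp: adj_def)
    then obtain p q where "p \<in> part (verts T) True" "q \<in> part (verts T) False" "{a, b} = {p, q}"
      using sides_G[of True] by (fastforce simp: sides_def)
    then show ?thesis using X(1) Y(1) disj by (auto simp: doubleton_eq_iff)
  qed
  have indep: "\<not> adj G a b" if "a \<in> Z" "b \<in> Z" for a b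
    using that opp[of a b] non[of a b] non[of b a] adj_sym[of G a b] X(1) Y(1) disj
    unfolding Z_def by blast
  have ind: "indep T ({v \<in> I. h s i v \<in> Z} \<union> {x \<in> L. h s 0 x \<in> Z})" if "i < k" for s i
  proof -
    have "h s i v \<in> Z" if v: "v \<in> {v \<in> I. h s i v \<in> Z} \<union> {x \<in> L. h s 0 x \<in> Z}" for v
      using v h_leaf[OF _ \<open>i < k\<close> k0] by auto
    then show ?thesis using indep adj_copy[OF _ that] unfolding indep_def by blast
  qed
  have "{x \<in> L. h False 0 x \<in> Z} \<inter> {x \<in> L. h True 0 x \<in> Z} = {}"
    using indep adj_leaves[OF _ k0 k0, of _ False] by auto
  then have "(\<Sum>i<k. card {v \<in> I. h False i v \<in> Z}) + (\<Sum>i<k. card {v \<in> I. h True i v \<in> Z}) +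
      card {x \<in> L. h False 0 x \<in> Z} + card {x \<in> L. h True 0 x \<in> Z} + k \<le> k * card I + card L \<or>
    (\<exists>F. proper_colouring T (\<lambda>v. v \<in> F) \<and>
      (\<forall>i<k. {v \<in> I. h False i v \<in> Z} \<union> {x \<in> L. h False 0 x \<in> Z} \<subseteq> F \<and>
        ({v \<in> I. h True i v \<in> Z} \<union> {x \<in> L. h True 0 x \<in> Z}) \<inter> F = {}))"
    using ind by (intro independent_traces) auto
  then show ?thesis
  proof
    assume "(\<Sum>i<k. card {v \<in> I. h False i v \<in> Z}) + (\<Sum>i<k. card {v \<in> I. h True i v \<in> Z}) +
      card {x \<in> L. h False 0 x \<in> Z} + card {x \<in> L. h True 0 x \<in> Z} + k \<le> k * card I + card L"
    then show ?thesis using cZ card_split[OF ZV] card_side by simp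
  next
    assume "\<exists>F. proper_colouring T (\<lambda>v. v \<in> F) \<and>
      (\<forall>i<k. {v \<in> I. h False i v \<in> Z} \<union> {x \<in> L. h False 0 x \<in> Z} \<subseteq> F \<and>
        ({v \<in> I. h True i v \<in> Z} \<union> {x \<in> L. h True 0 x \<in> Z}) \<inter> F = {})"
    then obtain F where F: "proper_colouring T (\<lambda>v. v \<in> F)"
      "\<And>i. i < k \<Longrightarrow> {v \<in> I. h False i v \<in> Z} \<union> {x \<in> L. h False 0 x \<in> Z} \<subseteq> F"
      "\<And>i. i < k \<Longrightarrow> ({v \<in> I. h True i v \<in> Z} \<union> {x \<in> L. h True 0 x \<in> Z}) \<inter> F = {}" by blast
    have F': "v \<in> F \<longleftrightarrow> \<not> s" if "i < k" "v \<in> verts T" "h s i v \<in> Z" for s i v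
    proof -
      have "v \<in> {v \<in> I. h s i v \<in> Z} \<union> {x \<in> L. h s 0 x \<in> Z}"
        using that h_leaf[OF _ that(1) k0] by auto
      then show ?thesis using F(2,3)[OF that(1)] by (cases s) (simp_all, blast+)
    qed
    obtain x where x: "x \<in> X" using X by blast
    then have "x \<in> part (verts T) True" "x \<in> Z" using X by (auto simp: Z_def)
    then obtain s i u where u: "i < k" "u \<in> verts T" "col u = s" "h s i u \<in> Z"
      by (auto simp: part_def)
    obtain y where y: "y \<in> Y" using Y by blast
    then have "y \<in> part (verts T) False" "y \<in> Z" using Y by (auto simp: Z_def)
    then obtain t j v where v: "j < k" "v \<in> verts T" "col v \<noteq> t" "h t j v \<in> Z"
      by (auto simp: part_def)
    \<comment> \<open>By \<open>F'\<close>, the colourings \<open>col\<close> and \<open>F\<close>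
      disagree at \<open>u\<close>, which comes from \<open>X\<close>, and agree at
      \<open>v\<close>, which comes from \<open>Y\<close>. In a connected graph two proper
      colourings agree everywhere or nowhere.\<close>
    have "(col u = (u \<in> F)) \<noteq> (col v = (v \<in> F))" using F'[of i u s] F'[of j v t] u v by auto
    then show ?thesis using proper_colouring_unique[OF con fin proper_col F(1)] u(2) v(2) by blast
  qed
qed

lemma extendable_G: "extendable k G"
proof (rule extendableI[OF fin_G connected_G])
  show "sides G (part (verts T) True) (part (verts T) False)" using sides_G[of True] by simp
  have "0 < card I" "0 < card L" using inner_nonempty leaves_nonempty finite_verts by (auto simp: card_gt_0_iff)
  then have "k * 1 \<le> k * card I" "0 < card L" by (auto intro!: mult_le_mono2)
  then show "k < card (part (verts T) True)" unfolding card_side by linarith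
qed (use expand_G card_side in simp_all)

section \<open>Degrees and counts\<close>

lemma degree_inner:
  assumes "v \<in> I" "i < k"
  shows "vdegree G (h s i v) = vdegree T v"
proof -
  have "{d \<in> edges G. h s i v \<in> ends G d} = \<epsilon> s i ` {e \<in> edges T. v \<in> ends T e}"
  proof (intro subset_antisym subsetI)
    fix d assume "d \<in> {d \<in> edges G. h s i v \<in> ends G d}"
    then have d: "d \<in> edges G" "h s i v \<in> ends G d" by auto
    from d(1) show "d \<in> \<epsilon> s i ` {e \<in> edges T. v \<in> ends T e}"
    proof (cases rule: edge_cases)
      case (tree_edge t j e)
      then obtain u where u: "u \<in> ends T e" "h s i v = h t j u" using d(2) ends_eps by auto
      then have "u \<in> verts T" using fin tree_edge by (auto simp: fin_graph_def)
      then have "s = t" "v = u" "i = j" using u(2) h_eq[of i j v u s t] assms tree_edge by auto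
      then show ?thesis using tree_edge u by blast
    next
      case (leaf_edge x)
      then have "h s i v = h False 0 x \<or> h s i v = h True 0 x" using d(2) ends_mu by auto
      then have "v = x" using assms leaf_edge leaves_subset k0 by (auto simp: h_eq)
      then show ?thesis using assms leaf_edge by simp
    qed
  next
    fix d assume "d \<in> \<epsilon> s i ` {e \<in> edges T. v \<in> ends T e}"
    then show "d \<in> {d \<in> edges G. h s i v \<in> ends G d}"
      using assms eps_edge ends_eps by auto
  qed
  moreover have "inj_on (\<epsilon> s i) {e \<in> edges T. v \<in> ends T e}"
    using assms(2) eps_eq by (auto intro: inj_onI)
  ultimately show ?thesis by (simp add: vdegree_def card_image)
qed

lemma edges_at_leaf:
  assumes x: "x \<in> L" "{e \<in> edges T. x \<in> ends T e} = {e0}"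
  shows "{d \<in> edges G. h s 0 x \<in> ends G d} = insert (\<mu> x) ((\<lambda>i. \<epsilon> s i e0) ` {..<k})"
proof (intro subset_antisym subsetI)
  have e0: "e0 \<in> edges T" "x \<in> ends T e0" using x(2) by auto
  have xT: "x \<in> verts T" using x(1) leaves_subset by auto
  fix d assume "d \<in> {d \<in> edges G. h s 0 x \<in> ends G d}"
  then have d: "d \<in> edges G" "h s 0 x \<in> ends G d" by auto
  from d(1) show "d \<in> insert (\<mu> x) ((\<lambda>i. \<epsilon> s i e0) ` {..<k})"
  proof (cases rule: edge_cases)
    case (tree_edge t j e)
    then obtain u where u: "u \<in> ends T e" "h s 0 x = h t j u" using d(2) ends_eps by auto
    then have "u \<in> verts T" using fin tree_edge by (auto simp: fin_graph_def)
    then have "s = t" "x = u" using u(2) h_eq[of 0 j x u s t] k0 xT tree_edge by auto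
    then have "e = e0" using x(2) u(1) tree_edge(2) by blast
    then show ?thesis using tree_edge \<open>s = t\<close> by blast
  next
    case (leaf_edge y)
    then have "h s 0 x = h False 0 y \<or> h s 0 x = h True 0 y" using d(2) ends_mu by auto
    then have "x = y" using xT leaf_edge leaves_subset k0 by (auto simp: h_eq)
    then show ?thesis using leaf_edge by simp
  qed
next
  have e0: "e0 \<in> edges T" "x \<in> ends T e0" using x(2) by auto
  fix d assume "d \<in> insert (\<mu> x) ((\<lambda>i. \<epsilon> s i e0) ` {..<k})"
  then show "d \<in> {d \<in> edges G. h s 0 x \<in> ends G d}"
  proof
    assume "d = \<mu> x"
    then show ?thesis using x(1) mu_edge ends_mu by (cases s) auto
  next
    assume "d \<in> (\<lambda>i. \<epsilon> s i e0) ` {..<k}"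
    then obtain i where i: "i < k" "d = \<epsilon> s i e0" by blast
    have "h s 0 x = h s i x" by (rule h_leaf[OF x(1) k0 i(1)])
    then show ?thesis using i e0 eps_edge ends_eps by auto
  qed
qed

lemma degree_leaf:
  assumes "x \<in> L"
  shows "vdegree G (h s 0 x) = k + 1"
proof -
  obtain e0 where e0: "e0 \<in> edges T" "{e \<in> edges T. x \<in> ends T e} = {e0}"
    using leaf_edge[OF assms] by metis
  have "inj_on (\<lambda>i. \<epsilon> s i e0) {..<k}" using e0(1) eps_eq by (auto intro: inj_onI)
  moreover have "\<mu> x \<notin> (\<lambda>i. \<epsilon> s i e0) ` {..<k}" using eps_mu e0(1) assms by (auto, metis)
  ultimately show ?thesis
    unfolding vdegree_def edges_at_leaf[OF assms e0(2)] by (simp add: card_image)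
qed

lemma card_small_degree: "card (verts_of_degree G (k + 1)) = 2 * card L"
proof -
  have "{v \<in> I. h s i v \<in> verts_of_degree G (k + 1)} = {}" if "i < k" for s i
    using degree_inner[OF _ that] inner_degree by (fastforce simp: verts_of_degree_def)
  then have "(\<Sum>i<k. card {v \<in> I. h s i v \<in> verts_of_degree G (k + 1)}) = 0" for s
    by (intro sum.neutral ballI) (metis card.empty lessThan_iff)
  moreover have "{x \<in> L. h s 0 x \<in> verts_of_degree G (k + 1)} = L" for s
    using degree_leaf h_in_verts leaves_subset k0 by (auto simp: verts_of_degree_def)
  moreover have "verts_of_degree G (k + 1) \<subseteq> verts G" by (auto simp: verts_of_degree_def)
  ultimately show ?thesis unfolding card_split[OF \<open>verts_of_degree G (k + 1) \<subseteq> verts G\<close>] by simp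
qed

lemma card_verts_G: "card (verts G) = 2 * (k * card I + card L)"
proof -
  have "finite (verts G)" using fin_G by (simp add: fin_graph_def)
  then have "finite (part (verts T) b)" for b
    using part_subset[OF subset_refl] finite_subset by blast
  then show ?thesis
    using sides_G[of True] card_side[of True] card_side[of False]
      card_Un_disjoint[of "part (verts T) True" "part (verts T) False"]
    by (auto simp: sides_def)
qed

lemma card_edges_G: "card (edges G) = 2 * k * card (edges T) + card L"
proof -
  let ?S = "(UNIV :: bool set) \<times> {..<k} \<times> edges T"
  have eq: "edges G = (\<lambda>(s, i, e). \<epsilon> s i e) ` ?S \<union> \<mu> ` L" by (force simp: edges_G)
  have "inj_on (\<lambda>(s, i, e). \<epsilon> s i e) ?S" by (rule inj_onI) (auto simp: eps_eq)
  then have "card ((\<lambda>(s, i, e). \<epsilon> s i e) ` ?S) = 2 * k * card (edges T)"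
    by (simp add: card_image card_cartesian_product)
  moreover have "card (\<mu> ` L) = card L" using mu_inj by (rule card_image)
  moreover have "(\<lambda>(s, i, e). \<epsilon> s i e) ` ?S \<inter> \<mu> ` L = {}" using eps_mu by auto
  ultimately show ?thesis unfolding eq using finite_verts by (subst card_Un_disjoint) auto
qed

subsection \<open>Minimality\<close>

text \<open>The copies of \<open>p\<close> are distinct, but leaves are shared between the copies.
  Injectivity of \<open>f\<close> therefore has to keep the outer ends apart.\<close>

lemma star_matching:
  assumes p: "p \<in> I" and J: "J \<subseteq> {..<k}" "inj_on f J" "f ` J \<subseteq> {e \<in> edges T. p \<in> ends T e}"
  shows "matching G ((\<lambda>i. \<epsilon> s i (f i)) ` J)"
  unfolding matching_def
proof (intro conjI ballI impI)
  show "(\<lambda>i. \<epsilon> s i (f i)) ` J \<subseteq> edges G" using J by (intro image_subsetI eps_edge) auto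
  fix d d' assume "d \<in> (\<lambda>i. \<epsilon> s i (f i)) ` J" "d' \<in> (\<lambda>i. \<epsilon> s i (f i)) ` J" "d \<noteq> d'"
  then obtain i j where ij: "i \<in> J" "j \<in> J" "d = \<epsilon> s i (f i)" "d' = \<epsilon> s j (f j)" "i \<noteq> j" by auto
  have e: "f i \<in> edges T" "p \<in> ends T (f i)" "f j \<in> edges T" "p \<in> ends T (f j)" using ij J by auto
  obtain a where a: "ends T (f i) = {p, a}" "a \<noteq> p" "adj T p a" using incident_edge[OF fin e(1,2)] by metis
  obtain b where b: "ends T (f j) = {p, b}" "b \<noteq> p" "adj T p b" using incident_edge[OF fin e(3,4)] by metis
  have "f i \<noteq> f j" using inj_onD[OF J(2)] ij by blast
  then have "a \<noteq> b" using tree_parallel_edges[OF tree e(1,3)] a b by auto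
  moreover have "a \<in> verts T" "b \<in> verts T" using a b adj_in_verts by blast+
  moreover have "i < k" "j < k" using ij J by auto
  ultimately show "ends G d \<inter> ends G d' = {}"
    using ij p e a b by (auto simp: ends_eps h_eq)
qed

text \<open>The neighbours of the glued leaf \<open>h s 0 x\<close> are the \<open>k\<close> copies
  of its tree neighbour \<open>p\<close> on side \<open>s\<close> and its partner on the other side.
  Whichever edge is deleted, the remaining \<open>k\<close> neighbours are covered by
  \<open>k\<close> disjoint edges that avoid \<open>h s 0 x\<close>.\<close>

lemma delete_edge_at_leaf:
  assumes x: "x \<in> L" and d: "d \<in> edges G" "h s 0 x \<in> ends G d"
  shows "\<not> extendable k (del_edge G d)"
proof -
  obtain e0 p where e0: "e0 \<in> edges T" "ends T e0 = {x, p}" "p \<in> I"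
    "{e \<in> edges T. x \<in> ends T e} = {e0}" "\<And>q. adj T x q \<longleftrightarrow> q = p"
    by (rule leaf_edge[OF x]) (rule that)
  define v where "v = h s 0 x"
  let ?E = "{e \<in> edges T. p \<in> ends T e} - {e0}"
  have xT: "x \<in> verts T" "x \<noteq> p" using x e0(3) leaves_subset by auto
  have star: "{e' \<in> edges G. v \<in> ends G e'} = insert (\<mu> x) ((\<lambda>i. \<epsilon> s i e0) ` {..<k})"
    unfolding v_def by (rule edges_at_leaf[OF x e0(4)])
  have "k + 2 \<le> card {e \<in> edges T. p \<in> ends T e}"
    using inner_degree[OF e0(3)] by (simp add: vdegree_def)
  then have "card {..<k} \<le> card ?E" using finite_verts e0 by (simp add: card_Diff_singleton_if)
  moreover have "finite ?E" using finite_verts by simp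
  \<comment> \<open>At least k + 1 edges at \<open>p\<close> differ from \<open>e0\<close>;
    \<open>f\<close> gives different ones to the \<open>k\<close> copies of
    \<open>p\<close>.\<close>
  ultimately obtain f where f: "f ` {..<k} \<subseteq> ?E" "inj_on f {..<k}"
    using card_le_inj[of "{..<k}" ?E] by blast
  have fi: "f i \<in> edges T" "p \<in> ends T (f i)" "f i \<noteq> e0" "x \<notin> ends T (f i)" if "i < k" for i
  proof -
    show "f i \<in> edges T" "p \<in> ends T (f i)" "f i \<noteq> e0" using f(1) that by auto
    then show "x \<notin> ends T (f i)" using e0(4) by blast
  qed
  define N where "N J = (\<lambda>i. \<epsilon> s i (f i)) ` J" for J
  have N: "matching G (N J)" "card (N J) = card J" if "J \<subseteq> {..<k}" for J
  proof -
    have "inj_on f J" using f(2) that by (rule inj_on_subset)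
    moreover have "f ` J \<subseteq> {e \<in> edges T. p \<in> ends T e}" using f(1) that by blast
    ultimately show "matching G (N J)" unfolding N_def by (intro star_matching[OF e0(3) that])
    have "inj_on (\<lambda>i. \<epsilon> s i (f i)) J" using that fi eps_eq by (intro inj_onI) (auto simp: subset_iff)
    then show "card (N J) = card J" unfolding N_def by (rule card_image)
  qed
  have N_cov: "h t 0 x \<notin> (\<Union>e\<in>N J. ends G e)" if "J \<subseteq> {..<k}" for J t
  proof -
    have "h t 0 x \<notin> ends G (\<epsilon> s i (f i))" if i: "i < k" for i
    proof
      assume "h t 0 x \<in> ends G (\<epsilon> s i (f i))"
      then obtain u where u: "u \<in> ends T (f i)" "h t 0 x = h s i u"
        using fi(1)[OF i] i ends_eps by auto
      then have "u \<in> verts T" using fi(1)[OF i] fin by (auto simp: fin_graph_def)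
      then have "x = u" using u(2) i k0 xT by (simp add: h_eq)
      then show False using u(1) fi(4)[OF i] by simp
    qed
    then show ?thesis using that by (auto simp: N_def)
  qed
  have N_d: "N J \<subseteq> edges (del_edge G d)" if J: "J \<subseteq> {..<k}" for J
  proof -
    have "d \<notin> N J" using N_cov[OF J, of s] d(2) by blast
    then show ?thesis using N(1)[OF J] by (auto simp: matching_def del_edge_def)
  qed
  have m_del: "matching (del_edge G d) M \<longleftrightarrow> matching G M \<and> d \<notin> M" for M
    by (auto simp: matching_def del_edge_def)
  have ends_del: "ends (del_edge G d) = ends G" and edges_del: "edges (del_edge G d) = edges G - {d}"
    and verts_del: "verts (del_edge G d) = verts G"
    by (simp_all add: del_edge_def)
  have meets: "ends G (\<epsilon> s i e0) \<inter> (\<Union>e\<in>N J. ends G e) \<noteq> {}" if "i \<in> J" "J \<subseteq> {..<k}" for i J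
  proof -
    have "i < k" using that by auto
    then have "h s i p \<in> ends G (\<epsilon> s i e0)" "h s i p \<in> ends G (\<epsilon> s i (f i))"
      using e0 fi[of i] ends_eps by auto
    then show ?thesis using that(1) by (auto simp: N_def)
  qed
  have vG: "v \<in> verts G" unfolding v_def using h_in_verts k0 xT by blast
  have "d \<in> insert (\<mu> x) ((\<lambda>i. \<epsilon> s i e0) ` {..<k})" using d star by (auto simp: v_def)
  then show ?thesis
  proof
    assume d_mu: "d = \<mu> x"
    show ?thesis
    proof (rule not_extendable_blocked[of _ "N {..<k}" _ v])
      show "matching (del_edge G d) (N {..<k})" using m_del N N_d[of "{..<k}"] by (auto simp: edges_del)
      show "card (N {..<k}) = k" using N(2)[of "{..<k}"] by simp
      fix e assume "e \<in> edges (del_edge G d)" "v \<in> ends (del_edge G d) e"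
      then have "e \<in> edges G - {d}" "v \<in> ends G e" by (simp_all only: edges_del ends_del)
      then have "e \<in> (\<lambda>i. \<epsilon> s i e0) ` {..<k}" using star d_mu by blast
      then show "ends (del_edge G d) e \<inter> (\<Union>e\<in>N {..<k}. ends (del_edge G d) e) \<noteq> {}"
        using meets[of _ "{..<k}"] unfolding ends_del by blast
    qed (use vG N_cov[OF subset_refl, of s] in \<open>simp_all add: verts_del ends_del v_def\<close>)
  next
    assume "d \<in> (\<lambda>i. \<epsilon> s i e0) ` {..<k}"
    then obtain j where j: "j < k" "d = \<epsilon> s j e0" by blast
    define J where "J = {..<k} - {j}"
    \<comment> \<open>Without the edge to copy \<open>j\<close> of \<open>p\<close> this copy need
      not be covered, but the partner of the leaf must be. An edge from that partner into its own
      side does this and stays clear of \<open>N J\<close>.\<close>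
    define g where "g = \<epsilon> (\<not> s) 0 e0"
    have J: "J \<subseteq> {..<k}" by (auto simp: J_def)
    have g: "g \<in> edges G" "ends G g = {h (\<not> s) 0 x, h (\<not> s) 0 p}"
      using e0 k0 eps_edge ends_eps by (auto simp: g_def)
    have "g \<noteq> d" using j e0(1) k0 by (simp add: g_def eps_eq)
    have g_N: "ends G g \<inter> ends G e = {}" if eN: "e \<in> N J" for e
    proof -
      obtain i where i: "i < k" "e = \<epsilon> s i (f i)" using eN J by (auto simp: N_def)
      have "h (\<not> s) 0 p \<notin> h s i ` ends T (f i)"
        using fi(1)[OF i(1)] fin i(1) k0 e0(3) by (auto simp: h_eq fin_graph_def subset_iff)
      moreover have "h (\<not> s) 0 x \<notin> ends G e" using N_cov[OF J] eN by blast
      ultimately show ?thesis using g(2) i fi(1) ends_eps by auto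
    qed
    have gN: "g \<notin> N J" using g_N g(2) by fastforce
    show ?thesis
    proof (rule not_extendable_blocked[of _ "insert g (N J)" _ v])
      have "matching G (insert g (N J))"
        unfolding matching_def
      proof (intro conjI ballI impI)
        show "insert g (N J) \<subseteq> edges G" using g(1) N(1)[OF J] by (auto simp: matching_def)
        fix e e' assume "e \<in> insert g (N J)" "e' \<in> insert g (N J)" "e \<noteq> e'"
        then show "ends G e \<inter> ends G e' = {}"
          using g_N[of e] g_N[of e'] N(1)[OF J] unfolding matching_def by (elim insertE) auto
      qed
      then show "matching (del_edge G d) (insert g (N J))"
        using m_del \<open>g \<noteq> d\<close> N_d[OF J] by (auto simp: edges_del)
      have "finite (N J)" using J by (auto simp: N_def intro: finite_subset)
      then show "card (insert g (N J)) = k"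
        using N(2)[OF J] gN j(1) by (simp add: J_def)
      have "h s 0 x \<noteq> h (\<not> s) 0 x" "h s 0 x \<noteq> h (\<not> s) 0 p" using xT e0(3) k0 by (simp_all add: h_eq)
      then show "v \<notin> (\<Union>e\<in>insert g (N J). ends (del_edge G d) e)"
        using N_cov[OF J, of s] g(2) by (simp add: ends_del v_def)
      fix e assume "e \<in> edges (del_edge G d)" "v \<in> ends (del_edge G d) e"
      then have "e \<noteq> d" "e \<in> insert (\<mu> x) ((\<lambda>i. \<epsilon> s i e0) ` {..<k})"
        using star by (auto simp: edges_del ends_del)
      then consider "e = \<mu> x" | i where "i \<in> J" "e = \<epsilon> s i e0" using j by (auto simp: J_def)
      then show "ends (del_edge G d) e \<inter> (\<Union>e\<in>insert g (N J). ends (del_edge G d) e) \<noteq> {}"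
      proof cases
        case 1
        then have "h (\<not> s) 0 x \<in> ends G e" using ends_mu[OF x] by (cases s) auto
        then show ?thesis using g(2) by (auto simp: ends_del)
      next
        case 2
        then show ?thesis using meets[OF 2(1) J] by (auto simp: ends_del)
      qed
    qed (use vG in \<open>simp add: verts_del\<close>)
  qed
qed

text \<open>
  Both colour classes meet the part of the graph on one side of the cut equally often, so a perfect
  matching uses as many cut edges in \<open>H\<close> as in \<open>H'\<close>; without \<open>\<epsilon> s j e\<close> the \<open>k\<close> cut edges on the other side
  cannot all be used.
\<close>

lemma delete_inner_edge:
  assumes j: "j < k" and e: "e \<in> edges T" "ends T e = {u, w}" "u \<in> I" "w \<in> I"
  shows "\<not> extendable k (del_edge G (\<epsilon> s j e))"
proof
  let ?D = "del_edge G (\<epsilon> s j e)"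
  assume ext: "extendable k ?D"
  obtain C where C: "C \<subseteq> verts T" "u \<in> C" "w \<notin> C"
    and cut: "\<And>f x y. f \<in> edges T \<Longrightarrow> ends T f = {x, y} \<Longrightarrow> x \<in> C \<Longrightarrow> y \<notin> C \<Longrightarrow> f = e"
    using tree_edge_cut[OF tree e(1,2)] by metis
  have uw: "u \<noteq> w" using C by auto
  \<comment> \<open>\<open>U\<close> consists of all copies of \<open>C\<close> on both sides. A
    matching edge at a leaf has both ends in \<open>U\<close> or none, so only the 2k copies of
    \<open>e\<close> leave \<open>U\<close>.\<close>
  define U where "U = part C True \<union> part C False"
  note mem = mem_part[OF subset_refl] mem_part[OF C(1)]
  have partU: "part (verts T) b \<inter> U = part C b" for b
  proof (intro set_eqI)
    fix z
    show "z \<in> part (verts T) b \<inter> U \<longleftrightarrow> z \<in> part C b"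
    proof (cases "z \<in> verts G")
      case True
      then obtain t i v where "i < k" "v \<in> verts T" "z = h t i v" by (auto simp: verts_G)
      then show ?thesis by (auto simp: U_def mem)
    next
      case False
      then show ?thesis using part_subset[of C] part_subset[of "verts T"] C(1) by blast
    qed
  qed
  have D: "fin_graph ?D" "sides ?D (part (verts T) True) (part (verts T) False)" "ends ?D = ends G"
    "edges ?D = edges G - {\<epsilon> s j e}"
    using fin_G sides_G[of True] by (auto simp: del_edge_def fin_graph_def sides_def)
  define M where "M = (\<lambda>i. \<epsilon> (\<not> s) i e) ` {..<k}"
  have eM: "ends G (\<epsilon> t i e) = {h t i u, h t i w}" if "i < k" for t i
    using that e by (simp add: ends_eps)
  have "ends G (\<epsilon> t i e) \<inter> ends G (\<epsilon> t i' e) = {}" if "i < k" "i' < k" "i \<noteq> i'" for t i i'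
    using that e(3,4) uw by (simp add: eM h_eq)
  moreover have "M \<subseteq> edges ?D" using D(4) eps_edge e(1) j by (auto simp: M_def eps_eq)
  ultimately have "matching ?D M" unfolding matching_def D(3) by (auto simp: M_def)
  moreover have cM: "card M = k"
  proof -
    have "inj_on (\<lambda>i. \<epsilon> (\<not> s) i e) {..<k}" using e(1) by (auto intro!: inj_onI simp: eps_eq)
    then show ?thesis by (simp add: M_def card_image)
  qed
  ultimately obtain P where P: "perfect_matching ?D P" "M \<subseteq> P"
    using ext by (auto simp: extendable_def)
  have PD: "P \<subseteq> edges G - {\<epsilon> s j e}" using P(1) D(4) by (auto simp: perfect_matching_def matching_def)
  have finP: "finite P" using PD fin_G by (auto simp: fin_graph_def intro: finite_subset)
  \<comment> \<open>The edges of \<open>P\<close> that leave \<open>U\<close> from an end of class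
    \<open>b\<close>.\<close>
  define X where "X b = {f \<in> P. ends G f \<inter> part C b \<noteq> {} \<and> ends G f \<inter> part C (\<not> b) = {}}" for b
  have "card (part (verts T) True \<inter> U) = card (part (verts T) False \<inter> U)"
    unfolding partU card_part[OF C(1)] by simp
  from perfect_matching_cut[OF D(1,2) P(1) this]
  have "card (X True) = card (X False)" by (simp add: X_def partU D(3))
  then have eq: "card (X b) = card (X (\<not> b))" for b by (cases b) simp_all
  have "M \<subseteq> X (col u = (\<not> s))"
  proof
    fix f assume f: "f \<in> M"
    then obtain i where i: "i < k" "f = \<epsilon> (\<not> s) i e" by (auto simp: M_def)
    have "h (\<not> s) i u \<in> part C b \<longleftrightarrow> (col u = (\<not> s)) = b" "h (\<not> s) i w \<notin> part C b" for b
      using mem(2)[OF i(1)] C e(3,4) by auto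
    then show "f \<in> X (col u = (\<not> s))" using f P(2) i eM[OF i(1)] by (auto simp: X_def)
  qed
  then have "k \<le> card (X (col u = (\<not> s)))"
    using cM finP by (metis (no_types, lifting) X_def card_mono finite_subset mem_Collect_eq subsetI)
  \<comment> \<open>The copies of \<open>u\<close> on the two sides lie in opposite classes, so
    balance between classes becomes balance between the cut edges of the two sides.\<close>
  also have "(col u = (\<not> s)) = (\<not> (col u = s))" by auto
  also have "card (X (\<not> (col u = s))) = card (X (col u = s))" by (rule eq[symmetric])
  finally have "k \<le> card (X (col u = s))" .
  moreover have "X (col u = s) \<subseteq> (\<lambda>i. \<epsilon> s i e) ` ({..<k} - {j})"
  proof
    fix f assume f: "f \<in> X (col u = s)"
    then have "f \<in> edges G" "f \<noteq> \<epsilon> s j e" using PD by (auto simp: X_def)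
    from this(1) show "f \<in> (\<lambda>i. \<epsilon> s i e) ` ({..<k} - {j})"
    proof (cases rule: edge_cases)
      case (tree_edge t i g)
      obtain y z where g: "ends T g = {y, z}" "y \<in> verts T" "z \<in> verts T" "adj T y z"
        using tree_edge_ends[OF tree_edge(2)] by metis
      have fe: "ends G f = {h t i y, h t i z}" using tree_edge g ends_eps by simp
      \<comment> \<open>If both ends were in \<open>C\<close>, the edge would meet both classes of
        \<open>U\<close>. So it crosses the cut and is a copy of \<open>e\<close>, and the colour of
        its end over \<open>u\<close> reveals its side.\<close>
      have "\<exists>y z. ends T g = {y, z} \<and> y \<in> C \<and> z \<notin> C \<and> (col y = t) = (col u = s)"
      proof -
        have m: "h t i v \<in> part C b \<longleftrightarrow> v \<in> C \<and> (col v = t) = b" if "v \<in> verts T" for v b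
          using mem(2)[OF tree_edge(1) that] .
        have col: "col y \<noteq> col z" by (rule col_adj[OF g(4)])
        have f': "h t i y \<in> part C (col u = s) \<or> h t i z \<in> part C (col u = s)"
          "h t i y \<notin> part C (\<not> (col u = s))" "h t i z \<notin> part C (\<not> (col u = s))"
          using f fe by (auto simp: X_def)
        have "(y \<in> C \<and> z \<notin> C \<and> (col y = t) = (col u = s)) \<or> (z \<in> C \<and> y \<notin> C \<and> (col z = t) = (col u = s))"
          using f' col unfolding m[OF g(2)] m[OF g(3)] by blast
        then show ?thesis using g(1) by (metis insert_commute)
      qed
      then obtain y z where yz: "ends T g = {y, z}" "y \<in> C" "z \<notin> C" "(col y = t) = (col u = s)" by blast
      then have "g = e" using cut tree_edge(2) by blast
      then have "y = u" using yz e(2) C by (auto simp: doubleton_eq_iff)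
      then have "t = s" using yz(4) by auto
      then show ?thesis using tree_edge \<open>g = e\<close> \<open>f \<noteq> \<epsilon> s j e\<close> by blast
    next
      case (leaf_edge x)
      have xT: "x \<in> verts T" using leaf_edge leaves_subset by auto
      \<comment> \<open>If \<open>x\<close> is in \<open>C\<close>, the two ends of its matching
        edge lie in opposite classes of \<open>U\<close>; otherwise neither is in \<open>U\<close>.
        Either way the edge is not in \<open>X\<close>.\<close>
      then show ?thesis
        using f leaf_edge ends_mu mem(2)[OF k0 xT] by (auto simp: X_def)
    qed
  qed
  then have "card (X (col u = s)) \<le> card ({..<k} - {j})"
    by (intro surj_card_le) auto
  moreover have "card ({..<k} - {j}) < k" using j by simp
  ultimately show False by linarith
qed

lemma minimal_G: "minimal_extendable k G"
  unfolding minimal_extendable_def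
proof (intro conjI ballI)
  fix d assume d: "d \<in> edges G"
  then show "\<not> extendable k (del_edge G d)"
  proof (cases rule: edge_cases)
    case (tree_edge s i e)
    obtain u w where uw: "ends T e = {u, w}" "u \<in> verts T" "w \<in> verts T"
      using tree_edge_ends[OF tree_edge(2)] by metis
    show ?thesis
    proof (cases "u \<in> L \<or> w \<in> L")
      case True
      then obtain x where x: "x \<in> L" "x \<in> ends T e" using uw by auto
      then have "h s 0 x \<in> ends G d"
        using tree_edge ends_eps h_leaf[OF x(1) k0, of i s] by auto
      then show ?thesis using delete_edge_at_leaf x(1) d by blast
    next
      case False
      then show ?thesis using delete_inner_edge[of i e u w s] tree_edge uw by auto
    qed
  next
    case (leaf_edge x)
    then have "h False 0 x \<in> ends G d" using ends_mu by auto
    then show ?thesis using delete_edge_at_leaf leaf_edge(1) d by blast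
  qed
qed (rule extendable_G)

end

subsection \<open>The exceptional trees and the main theorem\<close>

text \<open>If all degrees are 1, the degree sum gives |V| = 2 |E|, and |V| = |E| + 1 in a tree
  leaves only one edge.\<close>

lemma all_leaves_K2:
  assumes T: "is_tree T" and all: "verts T - leaves T = {}"
  shows "isomorphic_graphs T K2"
proof -
  have fin: "fin_graph T" using T by (simp add: is_tree_def)
  have "vdegree T v = 1" if "v \<in> verts T" for v
    using all that by (auto simp: leaves_def verts_of_degree_def)
  then have "card (verts T) = 2 * card (edges T)" using handshake[OF fin] by simp
  then have c: "card (edges T) = 1" "card (verts T) = 2" using tree_edge_count[OF T] by simp_all
  then obtain e where e: "edges T = {e}" by (auto simp: card_1_singleton_iff)
  have ce: "card (ends T e) = 2" "ends T e \<subseteq> verts T" using fin e by (auto simp: fin_graph_def)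
  then have eV: "ends T e = verts T" using c(2) fin by (intro card_subset_eq) (auto simp: fin_graph_def)
  obtain u w where uw: "ends T e = {u, w}" "u \<noteq> w" using ce(1) by (auto simp: card_2_iff)
  have "graph_isomorphism T K2 (\<lambda>v. if v = u then 0 else 1) (\<lambda>_. 0)"
    unfolding graph_isomorphism_def bij_betw_def inj_on_def K2_def
    using e uw eV[symmetric] by auto
  then show ?thesis unfolding isomorphic_graphs_def by blast
qed

text \<open>Every edge joins the only inner vertex to a leaf, so a numbering of the leaves from 1 on
  gives the isomorphism, with the centre sent to 0. The bound 2 places \<open>card L\<close> in the
  range of the excluded stars whenever it is below 2k.\<close>

lemma (in thick_tree) single_inner_K1:
  assumes one: "card I = 1"
  shows "isomorphic_graphs T (K1 (card L))" and "2 \<le> card L"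
proof -
  obtain c where c: "I = {c}" using one by (auto simp: card_1_singleton_iff)
  have "\<exists>e. e \<in> edges T \<and> ends T e = {x, c}" if "x \<in> L" for x
    using leaf_edge[OF that] c by (metis singletonD)
  then obtain d where d: "\<And>x. x \<in> L \<Longrightarrow> d x \<in> edges T \<and> ends T (d x) = {x, c}" by metis
  have cT: "c \<in> verts T" "c \<notin> L" using c by auto
  have dL: "d ` L = edges T"
  proof
    show "edges T \<subseteq> d ` L"
    proof
      fix e assume e: "e \<in> edges T"
      have "\<exists>x\<in>L. ends T e = {x, c}"
      proof -
        have "card (ends T e) = 2" "ends T e \<subseteq> verts T" using e fin by (auto simp: fin_graph_def)
        then obtain u v where uv: "ends T e = {u, v}" "u \<noteq> v" "u \<in> verts T" "v \<in> verts T"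
          by (auto simp: card_2_iff)
        then have "adj T u v" using e by (auto simp: adj_def)
        then have "u \<in> L \<Longrightarrow> v = c" using leaf_adj_inner c by blast
        moreover have "u = c \<and> v \<in> L" if "u \<notin> L"
        proof -
          have "u = c" using that uv(3) c by blast
          moreover have "v \<notin> I" using \<open>u = c\<close> uv(2) by (simp only: c singleton_iff) blast
          ultimately show ?thesis using uv(4) by blast
        qed
        ultimately show ?thesis using uv(1) by (metis insert_commute)
      qed
      then obtain x where "x \<in> L" "ends T e = {x, c}" by blast
      then have "e = d x" using tree_parallel_edges[OF tree e] d by metis
      then show "e \<in> d ` L" using \<open>x \<in> L\<close> by blast
    qed
  qed (use d in blast)
  have inj: "inj_on d L" using d cT by (intro inj_onI) (metis doubleton_eq_iff)
  have "k + 2 \<le> vdegree T c" using inner_degree c by blast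
  also have "\<dots> \<le> card (edges T)" unfolding vdegree_def using finite_verts by (intro card_mono) auto
  also have "\<dots> = card L" using inj dL by (metis card_image)
  finally show "2 \<le> card L" by simp
  obtain b where b: "bij_betw b L {1..card L}"
    using finite_same_card_bij[of L "{1..card L}"] finite_verts(2) by auto
  define f where "f v = (if v = c then 0 else b v)" for v
  have fL: "f x = b x" if "x \<in> L" for x using that cT by (auto simp: f_def)
  have bL: "b x \<in> {1..card L}" if "x \<in> L" for x using that b by (auto simp: bij_betw_def)
  have "verts T = insert c L" using c leaves_subset by auto
  moreover have "bij_betw f (insert c L) (insert 0 {1..card L})"
  proof -
    have "bij_betw f L {1..card L}" using b fL by (metis bij_betw_cong)
    then have "bij_betw f (L \<union> {c}) ({1..card L} \<union> {f c})"
      using cT by (intro notIn_Un_bij_betw) (auto simp: f_def)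
    then show ?thesis by (simp add: f_def)
  qed
  moreover have "insert 0 {1..card L} = {0..card L}" by auto
  ultimately have 1: "bij_betw f (verts T) {0..card L}" by simp
  have "bij_betw (inv_into L d) (edges T) L" using inj dL by (metis bij_betw_inv_into bij_betw_def)
  then have 2: "bij_betw (b \<circ> inv_into L d) (edges T) {1..card L}" using b by (rule bij_betw_trans)
  have "{0, (b \<circ> inv_into L d) e} = f ` ends T e" if e: "e \<in> edges T" for e
  proof -
    obtain x where x: "x \<in> L" "e = d x" using e dL by blast
    then have "(b \<circ> inv_into L d) e = b x" using inj by simp
    moreover have "ends T e = {x, c}" using d x by simp
    ultimately show ?thesis using fL[OF x(1)] by (auto simp: f_def)
  qed
  then have "graph_isomorphism T (K1 (card L)) f (b \<circ> inv_into L d)"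
    unfolding graph_isomorphism_def using 1 2 by (simp add: K1_def)
  then show "isomorphic_graphs T (K1 (card L))" unfolding isomorphic_graphs_def by blast
qed

lemma wide_treeI:
  assumes "1 \<le> k" "r_tree (k + 2) T" "\<not> isomorphic_graphs T K2"
    and "\<not> (\<exists>p. 2 \<le> p \<and> p < 2 * k \<and> isomorphic_graphs T (K1 p))"
  shows "wide_tree k T"
proof -
  interpret thick_tree k T
    using assms(1-3) all_leaves_K2 by unfold_locales (auto simp: r_tree_def)
  show ?thesis
    using assms(4) single_inner_K1 by unfold_locales (metis not_le)
qed

section \<open>Coordinates for an arbitrary leaf matching\<close>

lemma glue_eq: "glue T i u = glue T j v \<longleftrightarrow> u = v \<and> (i = j \<or> u \<in> leaves T)"
  by (auto simp: glue_def)

lemma leaf_matchedI: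
  fixes G :: "('v, 'e) mgraph"
  assumes wide: "wide_tree k T" and G: "isomorphic_leaf_matching k T G"
  shows "\<exists>h \<epsilon> \<mu>. leaf_matched k T G h \<epsilon> \<mu>"
proof -
  interpret wide_tree k T by (rule wide)
  obtain H H' :: "('v, 'e) mgraph" and L1 L2 \<phi> \<psi> M where
    fin_G: "fin_graph G" and H: "leaf_glued_copy k T H L1" and iso: "graph_isomorphism H H' \<phi> \<psi>"
    and disj: "verts H \<inter> verts H' = {}" "edges H \<inter> edges H' = {}" "M \<inter> (edges H \<union> edges H') = {}"
    and VG: "verts G = verts H \<union> verts H'" and EG: "edges G = edges H \<union> edges H' \<union> M"
    and endsH: "\<forall>e\<in>edges H. ends G e = ends H e" and endsH': "\<forall>e\<in>edges H'. ends G e = ends H' e"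
    and M: "bij_betw (ends G) M ((\<lambda>x. {x, \<phi> x}) ` L1)"
    using G unfolding isomorphic_leaf_matching_def by blast
  obtain f g where fg: "graph_isomorphism (leaf_glued k T) H f g" and L1: "L1 = f ` glued_leaves k T"
    using H unfolding leaf_glued_copy_def by blast
  define V0 where "V0 = (\<Union>i<k. glue T i ` verts T)"
  have f: "inj_on f V0" "f ` V0 = verts H" and g: "inj_on g (edges T \<times> {..<k})" "g ` (edges T \<times> {..<k}) = edges H"
    and fg_ends: "\<And>e i. e \<in> edges T \<Longrightarrow> i < k \<Longrightarrow> ends H (g (e, i)) = f ` glue T i ` ends T e"
    using fg by (auto simp: graph_isomorphism_def leaf_glued_def bij_betw_def V0_def)
  have \<phi>: "inj_on \<phi> (verts H)" "\<phi> ` verts H = verts H'" and \<psi>: "inj_on \<psi> (edges H)" "\<psi> ` edges H = edges H'"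
    and \<psi>_ends: "\<And>d. d \<in> edges H \<Longrightarrow> ends H' (\<psi> d) = \<phi> ` ends H d"
    using iso by (auto simp: graph_isomorphism_def bij_betw_def)
  \<comment> \<open>The vertices and edges of \<open>H'\<close> are named through the given
    isomorphism from \<open>H\<close>, so that matched leaves receive the same name on both
    sides.\<close>
  define h where "h s i v = (if s then \<phi> (f (glue T i v)) else f (glue T i v))" for s i v
  define \<epsilon> where "\<epsilon> s i e = (if s then \<psi> (g (e, i)) else g (e, i))" for s i e
  define \<mu> where "\<mu> x = inv_into M (ends G) {f (x, 0), \<phi> (f (x, 0))}" for x
  have glue_V0: "glue T i v \<in> V0" if "i < k" "v \<in> verts T" for i v
    using that by (auto simp: V0_def)
  have fH: "f (glue T i v) \<in> verts H" if "i < k" "v \<in> verts T" for i v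
    using that glue_V0 f(2) by blast
  have \<phi>H: "\<phi> (f (glue T i v)) \<in> verts H'" if "i < k" "v \<in> verts T" for i v
    using that fH \<phi>(2) by blast
  have gH: "g (e, i) \<in> edges H" if "i < k" "e \<in> edges T" for e i using that g(2) by blast
  have \<psi>H: "\<psi> (g (e, i)) \<in> edges H'" if "i < k" "e \<in> edges T" for e i using that gH \<psi>(2) by blast
  have hV: "h s i v \<in> verts G" if "i < k" "v \<in> verts T" for s i v
    using fH[OF that] \<phi>H[OF that] VG by (cases s) (simp_all add: h_def)
  have \<epsilon>E: "\<epsilon> s i e \<in> edges H \<union> edges H'" if "i < k" "e \<in> edges T" for s i e
    using gH[OF that] \<psi>H[OF that] by (cases s) (simp_all add: \<epsilon>_def)
  have glued: "glued_leaves k T = (\<lambda>x. (x, 0)) ` L"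
    using k_pos by (auto simp: glued_leaves_def glue_def lessThan_empty_iff)
  have glue0: "glue T 0 x = (x, 0)" for x by (simp add: glue_def)
  have L1': "(\<lambda>x. {x, \<phi> x}) ` L1 = (\<lambda>x. {f (x, 0), \<phi> (f (x, 0))}) ` L"
    unfolding L1 glued by (auto simp: image_image)
  have \<mu>: "\<mu> x \<in> M" "ends G (\<mu> x) = {f (x, 0), \<phi> (f (x, 0))}" if "x \<in> L" for x
  proof -
    have "{f (x, 0), \<phi> (f (x, 0))} \<in> ends G ` M" using M that unfolding bij_betw_def L1' by blast
    then show "\<mu> x \<in> M" "ends G (\<mu> x) = {f (x, 0), \<phi> (f (x, 0))}"
      unfolding \<mu>_def by (rule inv_into_into, rule f_inv_into_f)
  qed
  have \<mu>M: "\<mu> ` L = M"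
  proof
    show "M \<subseteq> \<mu> ` L"
    proof
      fix m assume m: "m \<in> M"
      then have "ends G m \<in> (\<lambda>x. {f (x, 0), \<phi> (f (x, 0))}) ` L" using M unfolding bij_betw_def L1' by blast
      then obtain x where x: "x \<in> L" "ends G m = {f (x, 0), \<phi> (f (x, 0))}" by blast
      then have "\<mu> x = m" using \<mu>[OF x(1)] m M unfolding bij_betw_def by (metis inj_onD)
      then show "m \<in> \<mu> ` L" using x(1) by blast
    qed
  qed (use \<mu> in blast)
  have leaf0: "f (x, 0) \<in> verts H" "\<phi> (f (x, 0)) \<in> verts H'" if "x \<in> L" for x
    using that fH[of 0 x] \<phi>H[of 0 x] k_pos leaves_subset by (auto simp: glue0)
  have "leaf_matched k T G h \<epsilon> \<mu>"
  proof unfold_locales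
    show "fin_graph G" by (rule fin_G)
  next
    fix s t i j u v
    assume ij: "i < k" "j < k" and uv: "u \<in> verts T" "v \<in> verts T"
    have ff: "f (glue T i u) = f (glue T j v) \<longleftrightarrow> glue T i u = glue T j v"
      using f(1) ij uv glue_V0 by (simp add: inj_on_eq_iff)
    have "\<phi> (f (glue T i u)) = \<phi> (f (glue T j v)) \<longleftrightarrow> f (glue T i u) = f (glue T j v)"
      using \<phi>(1) ij uv fH by (simp add: inj_on_eq_iff)
    moreover have "f (glue T i u) \<noteq> \<phi> (f (glue T j v))" "\<phi> (f (glue T i u)) \<noteq> f (glue T j v)"
      using disj(1) fH \<phi>H ij uv by (metis disjoint_iff)+
    ultimately show "h s i u = h t j v \<longleftrightarrow> s = t \<and> u = v \<and> (i = j \<or> u \<in> L)"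
      using ff glue_eq[of T i u j v] by (cases s; cases t) (simp_all add: h_def)
  next
    show "verts G = {h s i v | s i v. i < k \<and> v \<in> verts T}"
    proof
      show "verts G \<subseteq> {h s i v | s i v. i < k \<and> v \<in> verts T}"
      proof
        fix z assume "z \<in> verts G"
        then have "z \<in> f ` V0 \<union> \<phi> ` f ` V0" unfolding VG f(2) \<phi>(2) .
        then obtain i v where "i < k" "v \<in> verts T" "z = f (glue T i v) \<or> z = \<phi> (f (glue T i v))"
          by (auto simp: V0_def)
        then have "z = h False i v \<or> z = h True i v" by (simp add: h_def)
        then show "z \<in> {h s i v | s i v. i < k \<and> v \<in> verts T}" using \<open>i < k\<close> \<open>v \<in> verts T\<close> by blast
      qed
    qed (use hV in blast)
  next
    show "edges G = {\<epsilon> s i e | s i e. i < k \<and> e \<in> edges T} \<union> \<mu> ` L"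
    proof -
      have "edges H \<union> edges H' = {\<epsilon> s i e | s i e. i < k \<and> e \<in> edges T}"
      proof
        show "edges H \<union> edges H' \<subseteq> {\<epsilon> s i e | s i e. i < k \<and> e \<in> edges T}"
        proof
          fix z assume "z \<in> edges H \<union> edges H'"
          then have "z \<in> g ` (edges T \<times> {..<k}) \<union> \<psi> ` g ` (edges T \<times> {..<k})" unfolding g(2) \<psi>(2) .
          then obtain i e where "i < k" "e \<in> edges T" "z = g (e, i) \<or> z = \<psi> (g (e, i))" by blast
          then have "z = \<epsilon> False i e \<or> z = \<epsilon> True i e" by (simp add: \<epsilon>_def)
          then show "z \<in> {\<epsilon> s i e | s i e. i < k \<and> e \<in> edges T}" using \<open>i < k\<close> \<open>e \<in> edges T\<close> by blast
        qed
      qed (use \<epsilon>E in blast)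
      then show ?thesis unfolding EG \<mu>M by simp
    qed
  next
    fix s t i j e e'
    assume ij: "i < k" "j < k" and e: "e \<in> edges T" "e' \<in> edges T"
    have gg: "g (e, i) = g (e', j) \<longleftrightarrow> e = e' \<and> i = j"
      using inj_on_eq_iff[OF g(1), of "(e, i)" "(e', j)"] ij e by simp
    have "\<psi> (g (e, i)) = \<psi> (g (e', j)) \<longleftrightarrow> g (e, i) = g (e', j)"
      using \<psi>(1) ij e gH by (simp add: inj_on_eq_iff)
    moreover have "g (e, i) \<noteq> \<psi> (g (e', j))" "\<psi> (g (e, i)) \<noteq> g (e', j)"
      using disj(2) gH \<psi>H ij e by (metis disjoint_iff)+
    ultimately show "\<epsilon> s i e = \<epsilon> t j e' \<longleftrightarrow> s = t \<and> i = j \<and> e = e'"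
      using gg by (cases s; cases t) (auto simp: \<epsilon>_def)
  next
    show "inj_on \<mu> L"
    proof (rule inj_onI)
      fix x y assume xy: "x \<in> L" "y \<in> L" "\<mu> x = \<mu> y"
      then have "{f (x, 0), \<phi> (f (x, 0))} = {f (y, 0), \<phi> (f (y, 0))}" using \<mu>(2) by metis
      moreover have "f (x, 0) \<noteq> \<phi> (f (y, 0))"
        using leaf0(1)[OF xy(1)] leaf0(2)[OF xy(2)] disj(1) by auto
      ultimately have "f (x, 0) = f (y, 0)" by (auto simp: doubleton_eq_iff)
      moreover have "(x, 0) \<in> V0" "(y, 0) \<in> V0"
        using glue_V0[of 0] k_pos xy leaves_subset by (auto simp: glue0)
      ultimately have "(x, 0 :: nat) = (y, 0)" by (rule inj_onD[OF f(1)])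
      then show "x = y" by simp
    qed
  next
    fix s i e x assume "i < k" "e \<in> edges T" "x \<in> L"
    then have "\<epsilon> s i e \<in> edges H \<union> edges H'" "\<mu> x \<in> M" using \<epsilon>E \<mu>(1) by blast+
    then show "\<epsilon> s i e \<noteq> \<mu> x" using disj(3) by auto
  next
    fix s i e assume ie: "i < k" "e \<in> edges T"
    have "ends G (g (e, i)) = f ` glue T i ` ends T e" using fg_ends endsH gH ie by simp
    moreover have "ends G (\<psi> (g (e, i))) = \<phi> ` f ` glue T i ` ends T e"
      using fg_ends endsH' gH \<psi>H \<psi>_ends ie by simp
    ultimately show "ends G (\<epsilon> s i e) = h s i ` ends T e"
      by (cases s) (simp_all add: \<epsilon>_def h_def image_image)
  next
    fix x assume "x \<in> L"
    then show "ends G (\<mu> x) = {h False 0 x, h True 0 x}" using \<mu>(2) by (simp add: h_def glue0)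
  qed
  then show ?thesis by blast
qed

theorem theorem8p25:
  fixes k :: nat and T :: "('a, 'b) mgraph" and G :: "('v, 'e) mgraph"
  assumes "k \<ge> 1"
    and "r_tree (k + 2) T"
    and "\<not> isomorphic_graphs T K2"
    and "\<not> (\<exists>p. 2 \<le> p \<and> p < 2 * k \<and> isomorphic_graphs T (K1 p))"
    and "isomorphic_leaf_matching k T G"
  shows "minimal_extendable k G \<and> bipartite_graph G \<and>
    real (card (verts_of_degree G (k + 1))) =
      2 / (2 * real k - 1) * (real (card (edges G)) - real (card (verts G)) + 2 * real k) \<and>
    (regular_r_tree (k + 2) T \<longrightarrow>
      real (card (verts_of_degree G (k + 1))) = real (card (verts G)) / 2 + 2) \<and>
    (is_star T \<longrightarrow>
      real (card (edges G)) = (2 * real k + 1) * (real (card (verts G)) - 2 * real k) / 2)"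
proof -
  have "wide_tree k T" using assms(1-4) by (rule wide_treeI)
  from leaf_matchedI[OF this assms(5)] obtain h \<epsilon> \<mu> where "leaf_matched k T G h \<epsilon> \<mu>" by blast
  then interpret leaf_matched k T G h \<epsilon> \<mu> .
  have "card (verts T) = card I + card L"
    using finite_verts leaves_subset card_Un_disjoint[of I L] by (auto simp: Un_absorb2)
  then have mT: "card I + card L = card (edges T) + 1" using tree_edge_count[OF tree] by simp
  have n: "real (card (verts G)) = 2 * (real k * real (card I) + real (card L))"
    by (simp add: card_verts_G)
  have "real (card (edges T)) = real (card I) + real (card L) - 1" using mT by linarith
  then have m: "real (card (edges G)) = 2 * real k * (real (card I) + real (card L) - 1) + real (card L)"
    by (simp add: card_edges_G)
  have small: "real (card (verts_of_degree G (k + 1))) = 2 * real (card L)"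
    by (simp only: card_small_degree of_nat_mult of_nat_numeral)
  have "2 * real k - 1 \<noteq> 0" using k_pos by linarith
  \<comment> \<open>The terms in |I| cancel, since m = 2k (|I| + |L| - 1) + |L| and n = 2 (k |I| +
    |L|).\<close>
  moreover have "real (card (edges G)) - real (card (verts G)) + 2 * real k = (2 * real k - 1) * real (card L)"
    unfolding n m by (simp add: algebra_simps)
  ultimately have "real (card (verts_of_degree G (k + 1))) =
      2 / (2 * real k - 1) * (real (card (edges G)) - real (card (verts G)) + 2 * real k)"
    unfolding small by simp
  moreover have "real (card (verts_of_degree G (k + 1))) = real (card (verts G)) / 2 + 2"
    if reg: "regular_r_tree (k + 2) T"
  proof -
    have "(\<Sum>v\<in>verts T. vdegree T v) = (\<Sum>v\<in>I. vdegree T v) + (\<Sum>v\<in>L. vdegree T v)"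
      using finite_verts leaves_subset by (simp add: sum.subset_diff)
    also have "(\<Sum>v\<in>I. vdegree T v) = (\<Sum>v\<in>I. k + 2)"
      using reg by (intro sum.cong) (simp_all add: regular_r_tree_def)
    also have "(\<Sum>v\<in>L. vdegree T v) = (\<Sum>v\<in>L. 1)"
      by (intro sum.cong) (simp_all add: leaves_def verts_of_degree_def)
    finally have "card I * (k + 2) + card L = 2 * card (edges T)" using handshake[OF fin] by simp
    \<comment> \<open>The degree sum (k + 2) |I| + |L| equals 2 (|I| + |L| - 1) in a regular
      tree.\<close>
    then have "card I * k + 2 = card L" using mT by (simp add: algebra_simps)
    then have "real (card I * k + 2) = real (card L)" by simp
    then have "real (card I) * real k + 2 = real (card L)" by simp
    then show ?thesis unfolding small n by (simp add: field_simps)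
  qed
  \<comment> \<open>For |I| = 1 the counts become n = 2k + 2 |L| and m = (2k + 1) |L|.\<close>
  moreover have "real (card (edges G)) = (2 * real k + 1) * (real (card (verts G)) - 2 * real k) / 2"
    if "is_star T"
    using that unfolding is_star_def n m by (simp add: algebra_simps)
  moreover have "bipartite_graph G"
    using sides_G[of True] by (auto simp: bipartite_graph_def sides_def)
  ultimately show ?thesis using minimal_G by blast
qed

end
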